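(* Let $y_0$ be deterministic initial data and assume that $\mathcal{L}$ and $Q$ are diagonal in the common orthonormal basis $\{e_j\}_{j\in\mathbb{N}}$ of $L^2(D)$ with $\mathcal{L}e_j=\lambda_je_j$, $Qe_j=\mu_je_j$ and $\sum_{j=1}^{+\infty}\mu_j<+\infty$. Then, for every $s\in\mathscr{S}$ (that is, every $s\in(0,L)$ such that $\sum_{j=1}^{+\infty}\lambda_j^{-s}<+\infty$ and $\sum_{j=1}^{+\infty}\mu_j\lambda_j^{s}<+\infty$) with $y_0\in\mathcal{H}^{s/2}$, there exists a unique admissible solution $y=y(s)$ to the state equation $$dy(t)+\mathcal{L}^s y(t)\,dt=dW(t)\ \text{ in } D\times[0,T],\qquad y(\cdot,0)=y_0\ \text{ in } D.$$
   Context: $D\subset\mathbb{R}$ is a bounded open domain, $T>0$, $L\in(0,+\infty]$ is fixed, and $\langle\cdot,\cdot\rangle$ is the scalar product of $L^2(D)$. $\mathcal{L}:D(\mathcal{L})\subset L^2(D)\to L^2(D)$ is a densely defined, linear, self-adjoint, positive operator with compact inverse; $\{e_j\}_{j\in\mathbb{N}}$ is an orthonormal basis of $L^2(D)$ of eigenfunctions, $\mathcal{L}e_j=\lambda_je_j$, and the eigenvalues satisfy $\alpha<\lambda_1\le\lambda_2\le\dots$, $\lambda_j\to+\infty$, for some $\alpha>0$. For $s>0$, $\mathcal{L}^sv=\sum_{j}\lambda_j^s\langle v,e_j\rangle e_j$, and $\mathcal{H}^s=\{v\in L^2(D):\|v\|_{\mathcal{H}^s}<+\infty\}$ with $\|v\|_{\mathcal{H}^s}=\big(\sum_{j}\lambda_j^{2s}|\langle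 v,e_j\rangle|^2\big)^{1/2}$. $(\Omega,\mathcal{F},\mathbb{P})$ is a probability space with a normal filtration $\mathcal{F}_t$, and $W$ is an adapted $L^2(D)$-valued $Q$-Wiener process, with $Q$ linear, bounded, self-adjoint, positive semidefinite and of finite trace; $W(x,t)=\sum_{j}\sqrt{\mu_j}\,e_j(x)B_j(t)$ with $\{B_j\}$ i.i.d. standard real Brownian motions. The set of admissible controls $\mathscr{S}$ is the set of all $s\in(0,L)$ with $\sum_j\lambda_j^{-s}<+\infty$ and $\sum_j\mu_j\lambda_j^s<+\infty$. Definition (admissible solution). For $s\in\mathscr{S}$ and $y_0\in\mathcal{H}^{s/2}$, $y(s):\Omega\times D\times[0,T]\to\mathbb{R}$ is an admissible solution of the state equation with initial condition $y_0$ if: (1) the random variable $\omega\mapsto\|y(s,\omega)\|_{L^2([0,T];\mathcal{H}^s)}$ is almost surely finite; (2) $y(x,t)=\sum_{j=1}^{+\infty}y_j(t,s)e_j(x)$, where for each $j\in\mathbb{N}$ the stochastic process $y_j$ solves the Itô equation $dy_j(t)=-\lambda_j^sy_j(t)\,dt+\sqrt{\mu_j}\,dB_j(t)$, i.e. $y_j(t)=y_j(0)-\lambda_j^s\int_0^ty_j(\tau)\,d\tau+\sqrt{\mu_j}\,B_j(t)$ with $y_j(0)=\langle y_0,e_j\rangle$, for every $t\in(0,T)$. *)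

theory Defs
  imports "HOL-Probability.Probability"
begin

text \<open>
  Elements of the Hilbert space of square integrable functions on \<open>D\<close> are represented by
  functions \<open>real \<Rightarrow> real\<close>, identified when they agree almost everywhere on \<open>D\<close>.
\<close>

definition L2 :: "real set \<Rightarrow> (real \<Rightarrow> real) set" where
  "L2 D = {f \<in> borel_measurable (lebesgue_on D). integrable (lebesgue_on D) (\<lambda>x. (f x)\<^sup>2)}"

definition l2_inner :: "real set \<Rightarrow> (real \<Rightarrow> real) \<Rightarrow> (real \<Rightarrow> real) \<Rightarrow> real" where
  "l2_inner D f g = (LINT x|lebesgue_on D. f x * g x)"

definition l2_norm :: "real set \<Rightarrow> (real \<Rightarrow> real) \<Rightarrow> real" where
  "l2_norm D f = sqrt (l2_inner D f f)"

definition l2_eq :: "real set \<Rightarrow> (real \<Rightarrow> real) \<Rightarrow> (real \<Rightarrow> real) \<Rightarrow> bool" where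
  "l2_eq D f g \<longleftrightarrow> (AE x in lebesgue_on D. f x = g x)"

definition l2_tendsto :: "real set \<Rightarrow> ('i \<Rightarrow> real \<Rightarrow> real) \<Rightarrow> (real \<Rightarrow> real) \<Rightarrow> 'i filter \<Rightarrow> bool" where
  "l2_tendsto D f g G \<longleftrightarrow> ((\<lambda>i. l2_norm D (\<lambda>x. f i x - g x)) \<longlongrightarrow> 0) G"

text \<open>
  Membership in \<^const>\<open>L2\<close> is part of the next definition, because \<^const>\<open>l2_norm\<close> of a function
  that is not square integrable is \<open>0\<close>.
\<close>

definition l2_sums :: "real set \<Rightarrow> (nat \<Rightarrow> real \<Rightarrow> real) \<Rightarrow> (real \<Rightarrow> real) \<Rightarrow> bool" where
  "l2_sums D f g \<longleftrightarrow> (\<forall>j. f j \<in> L2 D) \<and> g \<in> L2 D \<and>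
     l2_tendsto D (\<lambda>n x. \<Sum>j<n. f j x) g sequentially"

definition l2_orthonormal_basis :: "real set \<Rightarrow> (nat \<Rightarrow> real \<Rightarrow> real) \<Rightarrow> bool" where
  "l2_orthonormal_basis D e \<longleftrightarrow> (\<forall>j. e j \<in> L2 D) \<and>
     (\<forall>i j. l2_inner D (e i) (e j) = (if i = j then 1 else 0)) \<and>
     (\<forall>f\<in>L2 D. l2_sums D (\<lambda>j x. l2_inner D f (e j) * e j x) f)"


section \<open>Operators\<close>

text \<open>
  A possibly unbounded linear operator is given by a domain and a map acting on representatives;
  both have to respect equality almost everywhere.
\<close>

definition l2_operator :: "real set \<Rightarrow> (real \<Rightarrow> real) set \<Rightarrow> ((real \<Rightarrow> real) \<Rightarrow> real \<Rightarrow> real) \<Rightarrow> bool" where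
  "l2_operator D \<D> A \<longleftrightarrow>
     \<D> \<subseteq> L2 D \<and> (\<lambda>x. 0) \<in> \<D> \<and>
     (\<forall>f\<in>\<D>. \<forall>g\<in>L2 D. l2_eq D f g \<longrightarrow> g \<in> \<D> \<and> l2_eq D (A f) (A g)) \<and>
     (\<forall>f\<in>\<D>. A f \<in> L2 D) \<and>
     (\<forall>f\<in>\<D>. \<forall>g\<in>\<D>. (\<lambda>x. f x + g x) \<in> \<D> \<and>
        l2_eq D (A (\<lambda>x. f x + g x)) (\<lambda>x. A f x + A g x)) \<and>
     (\<forall>f\<in>\<D>. \<forall>c. (\<lambda>x. c * f x) \<in> \<D> \<and> l2_eq D (A (\<lambda>x. c * f x)) (\<lambda>x. c * A f x))"

definition l2_dense :: "real set \<Rightarrow> (real \<Rightarrow> real) set \<Rightarrow> bool" where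
  "l2_dense D S \<longleftrightarrow> (\<forall>f\<in>L2 D. \<forall>\<epsilon>>0. \<exists>g\<in>S. l2_norm D (\<lambda>x. f x - g x) < \<epsilon>)"

text \<open>The graph of the adjoint coincides with the graph of the operator.\<close>

definition l2_self_adjoint :: "real set \<Rightarrow> (real \<Rightarrow> real) set \<Rightarrow> ((real \<Rightarrow> real) \<Rightarrow> real \<Rightarrow> real) \<Rightarrow> bool" where
  "l2_self_adjoint D \<D> A \<longleftrightarrow>
     (\<forall>g\<in>L2 D. \<forall>h\<in>L2 D.
        (\<forall>f\<in>\<D>. l2_inner D (A f) g = l2_inner D f h) \<longleftrightarrow> (g \<in> \<D> \<and> l2_eq D (A g) h))"

definition l2_positive :: "real set \<Rightarrow> (real \<Rightarrow> real) set \<Rightarrow> ((real \<Rightarrow> real) \<Rightarrow> real \<Rightarrow> real) \<Rightarrow> bool" where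
  "l2_positive D \<D> A \<longleftrightarrow> (\<forall>f\<in>\<D>. \<not> l2_eq D f (\<lambda>x. 0) \<longrightarrow> l2_inner D (A f) f > 0)"

definition l2_positive_semidefinite ::
    "real set \<Rightarrow> (real \<Rightarrow> real) set \<Rightarrow> ((real \<Rightarrow> real) \<Rightarrow> real \<Rightarrow> real) \<Rightarrow> bool" where
  "l2_positive_semidefinite D \<D> A \<longleftrightarrow> (\<forall>f\<in>\<D>. l2_inner D (A f) f \<ge> 0)"

definition l2_bounded_operator :: "real set \<Rightarrow> ((real \<Rightarrow> real) \<Rightarrow> real \<Rightarrow> real) \<Rightarrow> bool" where
  "l2_bounded_operator D A \<longleftrightarrow> l2_operator D (L2 D) A \<and>
     (\<exists>C. \<forall>f\<in>L2 D. l2_norm D (A f) \<le> C * l2_norm D f)"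

definition l2_compact_operator :: "real set \<Rightarrow> ((real \<Rightarrow> real) \<Rightarrow> real \<Rightarrow> real) \<Rightarrow> bool" where
  "l2_compact_operator D K \<longleftrightarrow> l2_operator D (L2 D) K \<and>
     (\<forall>f C. (\<forall>n::nat. f n \<in> L2 D \<and> l2_norm D (f n) \<le> C) \<longrightarrow>
        (\<exists>r g. strict_mono r \<and> g \<in> L2 D \<and> l2_tendsto D (\<lambda>n. K (f (r n))) g sequentially))"

definition l2_compact_inverse :: "real set \<Rightarrow> (real \<Rightarrow> real) set \<Rightarrow> ((real \<Rightarrow> real) \<Rightarrow> real \<Rightarrow> real) \<Rightarrow> bool" where
  "l2_compact_inverse D \<D> A \<longleftrightarrow> (\<exists>K. l2_compact_operator D K \<and>
     (\<forall>h\<in>L2 D. K h \<in> \<D> \<and> l2_eq D (A (K h)) h) \<and>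
     (\<forall>f\<in>\<D>. l2_eq D (K (A f)) f))"

text \<open>
  For a positive semidefinite operator the trace does not depend on the orthonormal basis, so
  finiteness is stated for the given basis \<open>e\<close>.
\<close>

definition l2_finite_trace :: "real set \<Rightarrow> (nat \<Rightarrow> real \<Rightarrow> real) \<Rightarrow> ((real \<Rightarrow> real) \<Rightarrow> real \<Rightarrow> real) \<Rightarrow> bool" where
  "l2_finite_trace D e Q \<longleftrightarrow> summable (\<lambda>j. l2_inner D (Q (e j)) (e j))"


section \<open>The spaces \<open>\<H>\<^sup>s\<close> and admissible controls\<close>

definition ennreal_sqrt :: "ennreal \<Rightarrow> ennreal" where
  "ennreal_sqrt x = (if x = \<infinity> then \<infinity> else ennreal (sqrt (enn2real x)))"

definition Hs_norm :: "real set \<Rightarrow> (nat \<Rightarrow> real \<Rightarrow> real) \<Rightarrow> (nat \<Rightarrow> real) \<Rightarrow> real \<Rightarrow> (real \<Rightarrow> real) \<Rightarrow> ennreal" where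
  "Hs_norm D e lam s v =
     ennreal_sqrt (\<Sum>j. ennreal (lam j powr (2 * s) * \<bar>l2_inner D v (e j)\<bar>\<^sup>2))"

definition Hs :: "real set \<Rightarrow> (nat \<Rightarrow> real \<Rightarrow> real) \<Rightarrow> (nat \<Rightarrow> real) \<Rightarrow> real \<Rightarrow> (real \<Rightarrow> real) set" where
  "Hs D e lam s = {v \<in> L2 D. Hs_norm D e lam s v < \<infinity>}"

definition L2Hs_norm ::
    "real set \<Rightarrow> (nat \<Rightarrow> real \<Rightarrow> real) \<Rightarrow> (nat \<Rightarrow> real) \<Rightarrow> real \<Rightarrow> real \<Rightarrow> (real \<Rightarrow> real \<Rightarrow> real) \<Rightarrow> ennreal" where
  "L2Hs_norm D e lam s T u =
     ennreal_sqrt (\<integral>\<^sup>+ t. (Hs_norm D e lam s (u t))\<^sup>2 \<partial>lebesgue_on {0..T})"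

definition admissible_controls :: "ereal \<Rightarrow> (nat \<Rightarrow> real) \<Rightarrow> (nat \<Rightarrow> real) \<Rightarrow> real set" where
  "admissible_controls L lam mu =
     {s. 0 < s \<and> ereal s < L \<and> summable (\<lambda>j. lam j powr (- s)) \<and> summable (\<lambda>j. mu j * lam j powr s)}"


section \<open>Filtrations, Brownian motions and Wiener processes\<close>

definition normal_filtration :: "'w measure \<Rightarrow> (real \<Rightarrow> 'w measure) \<Rightarrow> bool" where
  "normal_filtration M F \<longleftrightarrow>
     (\<forall>t\<ge>0. subalgebra M (F t)) \<and>
     (\<forall>r\<ge>0. \<forall>t\<ge>r. sets (F r) \<subseteq> sets (F t)) \<and>
     null_sets M \<subseteq> sets (F 0) \<and>
     (\<forall>t\<ge>0. sets (F t) = (\<Inter>u\<in>{t<..}. sets (F u)))"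

text \<open>The centred normal law with variance \<open>v\<close>; it is a point mass for \<open>v = 0\<close>.\<close>

definition centred_normal :: "real \<Rightarrow> real measure" where
  "centred_normal v =
     (if v = 0 then return borel 0 else density lborel (\<lambda>x. ennreal (normal_density 0 (sqrt v) x)))"

definition brownian_motion :: "'w measure \<Rightarrow> (real \<Rightarrow> 'w \<Rightarrow> real) \<Rightarrow> bool" where
  "brownian_motion M B \<longleftrightarrow>
     (\<forall>t\<ge>0. B t \<in> borel_measurable M) \<and>
     (AE \<omega> in M. B 0 \<omega> = 0) \<and>
     (AE \<omega> in M. continuous_on {0..} (\<lambda>t. B t \<omega>)) \<and>
     (\<forall>r\<ge>0. \<forall>t>r. distr M borel (\<lambda>\<omega>. B t \<omega> - B r \<omega>) = centred_normal (t - r)) \<and>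
     (\<forall>n. \<forall>\<tau>::nat \<Rightarrow> real. 0 \<le> \<tau> 0 \<and> (\<forall>i<n. \<tau> i \<le> \<tau> (Suc i)) \<longrightarrow>
        prob_space.indep_vars M (\<lambda>_. borel) (\<lambda>i \<omega>. B (\<tau> (Suc i)) \<omega> - B (\<tau> i) \<omega>) {..<n})"

text \<open>Whole processes, viewed as random elements of the path space, are independent.\<close>

definition independent_processes :: "'w measure \<Rightarrow> (nat \<Rightarrow> real \<Rightarrow> 'w \<Rightarrow> real) \<Rightarrow> bool" where
  "independent_processes M B \<longleftrightarrow>
     prob_space.indep_vars M (\<lambda>_. PiM {0..} (\<lambda>_. borel)) (\<lambda>j \<omega>. \<lambda>t\<in>{0..}. B j t \<omega>) UNIV"

text \<open>
  Since the space of square integrable functions is separable, its Borel sets are generated by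
  the functionals \<open>\<lambda>f. l2_inner D f v\<close>. A random element of it is therefore handled through the
  family of its inner products with all \<open>v\<close>; in particular its law is the centred Gaussian law with
  covariance \<open>C\<close> iff all these inner products are centred normal with variance \<open>l2_inner D (C v) v\<close>.
\<close>

definition adapted_l2_process ::
    "'w measure \<Rightarrow> (real \<Rightarrow> 'w measure) \<Rightarrow> real set \<Rightarrow> (real \<Rightarrow> 'w \<Rightarrow> real \<Rightarrow> real) \<Rightarrow> bool" where
  "adapted_l2_process M F D W \<longleftrightarrow>
     (\<forall>t\<ge>0. \<forall>\<omega>\<in>space M. W t \<omega> \<in> L2 D) \<and>
     (\<forall>t\<ge>0. \<forall>v\<in>L2 D. (\<lambda>\<omega>. l2_inner D (W t \<omega>) v) \<in> borel_measurable (F t))"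

definition Q_wiener_process ::
    "'w measure \<Rightarrow> real set \<Rightarrow> ((real \<Rightarrow> real) \<Rightarrow> real \<Rightarrow> real) \<Rightarrow> (real \<Rightarrow> 'w \<Rightarrow> real \<Rightarrow> real) \<Rightarrow> bool" where
  "Q_wiener_process M D Q W \<longleftrightarrow>
     (\<forall>t\<ge>0. \<forall>\<omega>\<in>space M. W t \<omega> \<in> L2 D) \<and>
     (\<forall>t\<ge>0. \<forall>v\<in>L2 D. (\<lambda>\<omega>. l2_inner D (W t \<omega>) v) \<in> borel_measurable M) \<and>
     (AE \<omega> in M. l2_eq D (W 0 \<omega>) (\<lambda>x. 0)) \<and>
     (AE \<omega> in M. \<forall>t\<ge>0. l2_tendsto D (\<lambda>r. W r \<omega>) (W t \<omega>) (at t within {0..})) \<and>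
     (\<forall>r\<ge>0. \<forall>t>r. \<forall>v\<in>L2 D.
        distr M borel (\<lambda>\<omega>. l2_inner D (\<lambda>x. W t \<omega> x - W r \<omega> x) v)
          = centred_normal ((t - r) * l2_inner D (Q v) v)) \<and>
     (\<forall>n. \<forall>\<tau>::nat \<Rightarrow> real. 0 \<le> \<tau> 0 \<and> (\<forall>i<n. \<tau> i \<le> \<tau> (Suc i)) \<longrightarrow>
        prob_space.indep_vars M (\<lambda>_. PiM (L2 D) (\<lambda>_. borel))
          (\<lambda>i \<omega>. \<lambda>v\<in>L2 D. l2_inner D (\<lambda>x. W (\<tau> (Suc i)) \<omega> x - W (\<tau> i) \<omega> x) v) {..<n})"


section \<open>Solutions\<close>

text \<open>
  \<open>Y\<close> is an adapted process on \<open>[0, T]\<close> solving \<open>dY = - a Y dt + \<sigma> dB\<close> with \<open>Y(0) = c\<close>. As the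
  diffusion coefficient is constant, the stochastic integral is \<open>\<sigma> * B\<close>.
\<close>

definition ito_solution ::
    "'w measure \<Rightarrow> (real \<Rightarrow> 'w measure) \<Rightarrow> real \<Rightarrow> real \<Rightarrow> real \<Rightarrow> (real \<Rightarrow> 'w \<Rightarrow> real) \<Rightarrow> real \<Rightarrow>
      (real \<Rightarrow> 'w \<Rightarrow> real) \<Rightarrow> bool" where
  "ito_solution M F T a \<sigma> B c Y \<longleftrightarrow>
     (\<forall>t\<in>{0..T}. Y t \<in> borel_measurable (F t)) \<and>
     (AE \<omega> in M. Y 0 \<omega> = c) \<and>
     (AE \<omega> in M. \<forall>t\<in>{0<..<T}.
        integrable (lebesgue_on {0..t}) (\<lambda>\<tau>. Y \<tau> \<omega>) \<and>
        Y t \<omega> = Y 0 \<omega> - a * (LINT \<tau>|lebesgue_on {0..t}. Y \<tau> \<omega>) + \<sigma> * B t \<omega>)"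

text \<open>
  The value \<open>y(x, t)\<close> at the sample point \<open>\<omega>\<close> is written \<open>y t \<omega> x\<close>. The equation is imposed for
  \<open>0 < t < T\<close> only, so the value at the single time \<open>T\<close> is not determined by it, and uniqueness
  refers to the time interval \<open>{0..<T}\<close>.
\<close>

definition admissible_solution ::
    "'w measure \<Rightarrow> (real \<Rightarrow> 'w measure) \<Rightarrow> real set \<Rightarrow> real \<Rightarrow> (nat \<Rightarrow> real \<Rightarrow> real) \<Rightarrow>
      (nat \<Rightarrow> real) \<Rightarrow> (nat \<Rightarrow> real) \<Rightarrow> (nat \<Rightarrow> real \<Rightarrow> 'w \<Rightarrow> real) \<Rightarrow>
      real \<Rightarrow> (real \<Rightarrow> real) \<Rightarrow> (real \<Rightarrow> 'w \<Rightarrow> real \<Rightarrow> real) \<Rightarrow> bool" where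
  "admissible_solution M F D T e lam mu B s y0 y \<longleftrightarrow>
     (\<lambda>\<omega>. L2Hs_norm D e lam s T (\<lambda>t. y t \<omega>)) \<in> borel_measurable M \<and>
     (AE \<omega> in M. L2Hs_norm D e lam s T (\<lambda>t. y t \<omega>) < \<infinity>) \<and>
     (\<exists>Y :: nat \<Rightarrow> real \<Rightarrow> 'w \<Rightarrow> real.
        (AE \<omega> in M. \<forall>t\<in>{0..T}. l2_sums D (\<lambda>j x. Y j t \<omega> * e j x) (y t \<omega>)) \<and>
        (\<forall>j. ito_solution M F T (lam j powr s) (sqrt (mu j)) (B j) (l2_inner D y0 (e j)) (Y j)))"

end

theory Submission
  imports Defs
begin

text \<open>
  Coordinatewise the equation is an Ornstein--Uhlenbeck equation with additive noise, so it can be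
  solved path by path, with uniqueness from the linear integral equation. Writing the solution
  as an average of the increments of the noise, Jensen's inequality gives
  \<open>E (Y\<^sub>j t)\<^sup>2 \<le> 2 c\<^sub>j\<^sup>2 exp (-2 a\<^sub>j t) + 2 \<mu>\<^sub>j / a\<^sub>j\<close> with \<open>a\<^sub>j = \<lambda>\<^sub>j\<^sup>s\<close>, hence
  \<open>\<integral>\<^sub>0\<^sup>T \<Sum>\<^sub>j (a\<^sub>j Y\<^sub>j t)\<^sup>2 dt\<close> is almost surely finite. By Cauchy--Schwarz the terms of
  \<open>Y\<^sub>j t = c\<^sub>j - \<integral>\<^sub>0\<^sup>t a\<^sub>j Y\<^sub>j + \<langle>W t, e\<^sub>j\<rangle>\<close> are then square summable in \<open>j\<close> for all \<open>t\<close> simultaneously, and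
  Riesz--Fischer yields the solution.
\<close>


section \<open>Square integrable functions\<close>

text \<open>The smoothing of the linear part pays for the regularity. In the norm of
  \<open>L2Hs_norm\<close> the j-th coordinate carries the weight \<open>(a j)^2\<close>, while its
  second moment integrated over [0, T] is at most
  \<open>(c j)^2 / a j + 2 * T * (mu j / a j)\<close>. One power of \<open>a j\<close> is left over
  in each term: \<open>a j * (c j)^2\<close> is summable because \<open>y0\<close> has order s/2,
  and \<open>mu j * a j\<close> because s is admissible.

  Adaptedness decides which noise drives the construction. The filtration is tied to
  \<open>W\<close>, whereas each \<open>B j\<close> is only known to be measurable with respect to
  \<open>M\<close>. The coordinates are therefore solved with forcing
  \<open>l2_inner D (W t \<omega>) (e j)\<close>, and \<open>sqrt (mu j) * B j\<close> enters
  through an almost sure identity valid at all times at once.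

  Moment bounds at a fixed t leave an exceptional set that depends on t. Referring everything to the
  finiteness of one random variable, the squared norm \<open>G\<close>, leaves a single exceptional
  event for all times.\<close>

lemma L2_iff:
  "f \<in> L2 D \<longleftrightarrow> f \<in> borel_measurable (lebesgue_on D) \<and> integrable (lebesgue_on D) (\<lambda>x. (f x)\<^sup>2)"
  by (simp add: L2_def)

lemma L2_zero [simp]: "(\<lambda>x. 0) \<in> L2 D"
  by (simp add: L2_iff)

lemma L2_mult_integrable:
  assumes "f \<in> L2 D" "g \<in> L2 D"
  shows "integrable (lebesgue_on D) (\<lambda>x. f x * g x)"
proof (rule Bochner_Integration.integrable_bound)
  show "integrable (lebesgue_on D) (\<lambda>x. (f x)\<^sup>2 + (g x)\<^sup>2)"
    using assms by (auto simp: L2_iff)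
  show "(\<lambda>x. f x * g x) \<in> borel_measurable (lebesgue_on D)"
    using assms by (auto simp: L2_iff)
  show "AE x in lebesgue_on D. norm (f x * g x) \<le> norm ((f x)\<^sup>2 + (g x)\<^sup>2)"
  proof (rule AE_I2)
    fix x
    have "0 \<le> (\<bar>f x\<bar> - \<bar>g x\<bar>)\<^sup>2" "0 \<le> \<bar>f x * g x\<bar>"
      by auto
    then have "\<bar>f x * g x\<bar> \<le> (f x)\<^sup>2 + (g x)\<^sup>2"
      unfolding power2_diff abs_mult power2_abs by linarith
    then show "norm (f x * g x) \<le> norm ((f x)\<^sup>2 + (g x)\<^sup>2)"
      by simp
  qed
qed

lemma L2_scale: "f \<in> L2 D \<Longrightarrow> (\<lambda>x. c * f x) \<in> L2 D"
  by (auto simp: L2_iff power_mult_distrib)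

lemma L2_add:
  assumes "f \<in> L2 D" "g \<in> L2 D"
  shows "(\<lambda>x. f x + g x) \<in> L2 D"
  using assms L2_mult_integrable[OF assms]
  by (auto simp: L2_iff power2_sum mult.assoc)

lemma L2_diff:
  assumes "f \<in> L2 D" "g \<in> L2 D"
  shows "(\<lambda>x. f x - g x) \<in> L2 D"
  using L2_add[OF assms(1) L2_scale[OF assms(2), of "-1"]] by simp

lemma L2_sum:
  assumes "\<And>i. i \<in> I \<Longrightarrow> f i \<in> L2 D"
  shows "(\<lambda>x. \<Sum>i\<in>I. f i x) \<in> L2 D"
  using assms by (induction I rule: infinite_finite_induct) (auto intro: L2_add)

lemma l2_inner_commute: "l2_inner D f g = l2_inner D g f"
  by (simp add: l2_inner_def mult.commute)

lemma l2_inner_scale_left: "l2_inner D (\<lambda>x. c * f x) g = c * l2_inner D f g"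
  by (simp add: l2_inner_def mult.assoc)

lemma l2_inner_diff_left:
  assumes "f \<in> L2 D" "g \<in> L2 D" "h \<in> L2 D"
  shows "l2_inner D (\<lambda>x. f x - g x) h = l2_inner D f h - l2_inner D g h"
  using assms L2_mult_integrable by (simp add: l2_inner_def left_diff_distrib)

lemma l2_inner_sum_left:
  assumes "\<And>i. i \<in> I \<Longrightarrow> f i \<in> L2 D" "h \<in> L2 D"
  shows "l2_inner D (\<lambda>x. \<Sum>i\<in>I. f i x) h = (\<Sum>i\<in>I. l2_inner D (f i) h)"
  using assms L2_mult_integrable by (simp add: l2_inner_def sum_distrib_right)

lemma l2_inner_self: "l2_inner D f f = (LINT x|lebesgue_on D. (f x)\<^sup>2)"
  by (simp add: l2_inner_def power2_eq_square)

lemma l2_inner_self_nonneg: "l2_inner D f f \<ge> 0"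
  by (simp add: l2_inner_self)

lemma l2_inner_diff_self:
  assumes "f \<in> L2 D" "g \<in> L2 D"
  shows "l2_inner D (\<lambda>x. f x - g x) (\<lambda>x. f x - g x) =
    l2_inner D f f - 2 * l2_inner D f g + l2_inner D g g"
proof -
  have "l2_inner D (\<lambda>x. f x - g x) (\<lambda>x. f x - g x) =
      l2_inner D f (\<lambda>x. f x - g x) - l2_inner D g (\<lambda>x. f x - g x)"
    using assms by (simp add: l2_inner_diff_left L2_diff)
  also have "\<dots> = l2_inner D (\<lambda>x. f x - g x) f - l2_inner D (\<lambda>x. f x - g x) g"
    by (simp add: l2_inner_commute)
  also have "\<dots> = l2_inner D f f - 2 * l2_inner D f g + l2_inner D g g"
    using assms by (simp add: l2_inner_diff_left l2_inner_commute[of D g f])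
  finally show ?thesis .
qed

text \<open>Cauchy-Schwarz for a unit vector: removing from \<open>f\<close> its projection
  \<open>b * u\<close> leaves the squared norm \<open>l2_inner D f f - b^2\<close>, which is
  nonnegative.\<close>

lemma abs_l2_inner_le_l2_norm:
  assumes "f \<in> L2 D" "u \<in> L2 D" and u: "l2_inner D u u = 1"
  shows "\<bar>l2_inner D f u\<bar> \<le> l2_norm D f"
proof -
  define b where "b = l2_inner D f u"
  have "0 \<le> l2_inner D (\<lambda>x. f x - b * u x) (\<lambda>x. f x - b * u x)"
    by (rule l2_inner_self_nonneg)
  also have "\<dots> = l2_inner D f f - b\<^sup>2"
    using assms
    by (simp add: l2_inner_diff_self L2_scale l2_inner_commute[of D f "\<lambda>x. b * u x"]
        l2_inner_scale_left l2_inner_commute[of D u "\<lambda>x. b * u x"] l2_inner_commute[of D u f]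
        flip: b_def) (simp add: power2_eq_square)
  finally show ?thesis
    unfolding b_def l2_norm_def by (simp add: real_le_rsqrt)
qed

text \<open>Membership in \<open>L2\<close> is asked only eventually so that the filter may be
  \<open>at t within {0..}\<close>: nothing is known about \<open>W r\<close> at negative
  times.\<close>

lemma l2_tendsto_imp_inner_tendsto:
  assumes lim: "l2_tendsto D f g G" and f: "\<forall>\<^sub>F i in G. f i \<in> L2 D" and "g \<in> L2 D"
    and u: "u \<in> L2 D" "l2_inner D u u = 1"
  shows "((\<lambda>i. l2_inner D (f i) u) \<longlongrightarrow> l2_inner D g u) G"
proof (rule LIM_zero_cancel, rule Lim_null_comparison)
  show "\<forall>\<^sub>F i in G. norm (l2_inner D (f i) u - l2_inner D g u) \<le> l2_norm D (\<lambda>x. f i x - g x)"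
    using f
  proof eventually_elim
    case (elim i)
    then show ?case
      using abs_l2_inner_le_l2_norm[OF L2_diff[OF elim \<open>g \<in> L2 D\<close>] u] assms(3) u
      by (simp add: l2_inner_diff_left)
  qed
  show "((\<lambda>i. l2_norm D (\<lambda>x. f i x - g x)) \<longlongrightarrow> 0) G"
    using lim by (simp add: l2_tendsto_def)
qed

lemma l2_norm_zero_imp_eq:
  assumes f: "f \<in> L2 D" and g: "g \<in> L2 D" and z: "l2_norm D (\<lambda>x. f x - g x) = 0"
  shows "l2_eq D f g"
proof -
  have "(LINT x|lebesgue_on D. (f x - g x)\<^sup>2) = 0"
    using z by (simp add: l2_norm_def l2_inner_self)
  moreover have "integrable (lebesgue_on D) (\<lambda>x. (f x - g x)\<^sup>2)"
    using L2_diff[OF f g] by (simp add: L2_iff)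
  ultimately have "AE x in lebesgue_on D. (f x - g x)\<^sup>2 = 0"
    by (subst (asm) integral_nonneg_eq_0_iff_AE) auto
  then show ?thesis
    by (simp add: l2_eq_def)
qed

lemma ennreal_l2_inner_self:
  assumes "f \<in> L2 D"
  shows "(\<integral>\<^sup>+ x. ennreal ((f x)\<^sup>2) \<partial>lebesgue_on D) = ennreal (l2_inner D f f)"
  using assms by (simp add: l2_inner_self nn_integral_eq_integral L2_iff)


section \<open>Expansions in an orthonormal basis\<close>

context
  fixes D :: "real set" and e :: "nat \<Rightarrow> real \<Rightarrow> real"
  assumes basis: "l2_orthonormal_basis D e"
begin

lemma basis_L2: "e j \<in> L2 D"
  using basis by (simp add: l2_orthonormal_basis_def)

lemma basis_inner: "l2_inner D (e i) (e j) = (if i = j then 1 else 0)"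
  using basis by (simp add: l2_orthonormal_basis_def)

lemma partial_sum_L2: "(\<lambda>x. \<Sum>j\<in>I. c j * e j x) \<in> L2 D"
  by (intro L2_sum L2_scale basis_L2)

lemma partial_sum_inner:
  assumes "finite I"
  shows "l2_inner D (\<lambda>x. \<Sum>j\<in>I. c j * e j x) (e k) = (if k \<in> I then c k else 0)"
  using assms
  by (simp add: l2_inner_sum_left L2_scale basis_L2 l2_inner_scale_left basis_inner if_distrib
      cong: if_cong)

lemma inner_partial_sum:
  assumes "finite I" "f \<in> L2 D"
  shows "l2_inner D (\<lambda>x. \<Sum>j\<in>I. c j * e j x) f = (\<Sum>j\<in>I. c j * l2_inner D f (e j))"
  using assms
  by (simp add: l2_inner_sum_left L2_scale basis_L2 l2_inner_scale_left l2_inner_commute[of D f])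

lemma partial_sum_inner_self:
  assumes "finite I"
  shows "l2_inner D (\<lambda>x. \<Sum>j\<in>I. c j * e j x) (\<lambda>x. \<Sum>j\<in>I. c j * e j x) = (\<Sum>j\<in>I. (c j)\<^sup>2)"
  using assms
  by (simp add: inner_partial_sum partial_sum_L2 partial_sum_inner power2_eq_square)

text \<open>The k-th coefficient is continuous under convergence in norm, and that of the n-th
  partial sum equals \<open>c k\<close> as soon as n > k.\<close>

lemma l2_sums_coefficient:
  assumes "l2_sums D (\<lambda>j x. c j * e j x) g"
  shows "l2_inner D g (e k) = c k"
proof (rule LIMSEQ_unique)
  show "(\<lambda>n. l2_inner D (\<lambda>x. \<Sum>j<n. c j * e j x) (e k)) \<longlonglongrightarrow> l2_inner D g (e k)"
    using assms
    by (intro l2_tendsto_imp_inner_tendsto) (auto simp: l2_sums_def partial_sum_L2 basis_L2 basis_inner)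
  show "(\<lambda>n. l2_inner D (\<lambda>x. \<Sum>j<n. c j * e j x) (e k)) \<longlonglongrightarrow> c k"
  proof (rule tendsto_eventually)
    show "\<forall>\<^sub>F n in sequentially. l2_inner D (\<lambda>x. \<Sum>j<n. c j * e j x) (e k) = c k"
      using eventually_gt_at_top[of k] by eventually_elim (simp add: partial_sum_inner)
  qed
qed

text \<open>Bessel's inequality: the squared distance from \<open>f\<close> to its n-th partial sum
  is \<open>l2_inner D f f\<close> minus the sum of the first n squared coefficients.\<close>

lemma summable_coefficients:
  assumes f: "f \<in> L2 D"
  shows "summable (\<lambda>j. (l2_inner D f (e j))\<^sup>2)"
proof (rule summableI_nonneg_bounded)
  fix n
  let ?c = "\<lambda>j. l2_inner D f (e j)" let ?S = "\<lambda>x. \<Sum>j<n. ?c j * e j x"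
  have "0 \<le> l2_inner D (\<lambda>x. ?S x - f x) (\<lambda>x. ?S x - f x)"
    by (rule l2_inner_self_nonneg)
  also have "\<dots> = l2_inner D f f - (\<Sum>j<n. (?c j)\<^sup>2)"
    using f
    by (simp add: l2_inner_diff_self partial_sum_L2 partial_sum_inner_self inner_partial_sum)
      (simp add: power2_eq_square)
  finally show "(\<Sum>j<n. (?c j)\<^sup>2) \<le> l2_inner D f f"
    by simp
qed simp

lemma l2_eq_if_same_coefficients:
  assumes f: "f \<in> L2 D" and g: "g \<in> L2 D"
    and eq: "\<And>j. l2_inner D f (e j) = l2_inner D g (e j)"
  shows "l2_eq D f g"
proof -
  \<comment> \<open>All coefficients of the difference vanish, so every partial sum is 0 and the
    error is a constant sequence tending to 0. The order \<open>g - f\<close> makes that constant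
    literally the norm of \<open>f - g\<close>.\<close>
  have "l2_sums D (\<lambda>j x. l2_inner D (\<lambda>x. g x - f x) (e j) * e j x) (\<lambda>x. g x - f x)"
    using basis L2_diff[OF g f] by (simp add: l2_orthonormal_basis_def)
  then have "(\<lambda>n::nat. l2_norm D (\<lambda>x. f x - g x)) \<longlonglongrightarrow> 0"
    by (simp add: l2_sums_def l2_tendsto_def l2_inner_diff_left f g basis_L2 eq)
  then have "l2_norm D (\<lambda>x. f x - g x) = 0"
    by (simp add: LIMSEQ_const_iff)
  then show ?thesis
    using f g by (rule l2_norm_zero_imp_eq[rotated 2])
qed

text \<open>
  Riesz--Fischer. Along a subsequence with squared increments at most \<open>4\<^sup>-\<^sup>k\<close> the bound
  \<open>\<bar>u\<bar> \<le> 2\<^sup>-\<^sup>k + 2\<^sup>k u\<^sup>2\<close> makes the partial sums converge almost everywhere, and Fatou's lemma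
  identifies the limit.
\<close>

lemma square_summable_imp_l2_sums:
  assumes c: "summable (\<lambda>j. (c j)\<^sup>2)"
  shows "\<exists>g. l2_sums D (\<lambda>j x. c j * e j x) g"
proof -
  define S where "S n x = (\<Sum>j<n. c j * e j x)" for n x
  have S_L2: "S n \<in> L2 D" for n
    unfolding S_def by (rule partial_sum_L2)
  have S_meas [measurable]: "S n \<in> borel_measurable (lebesgue_on D)" for n
    using S_L2 by (simp add: L2_iff)
  have S_diff: "l2_inner D (\<lambda>x. S n x - S m x) (\<lambda>x. S n x - S m x) = (\<Sum>j\<in>{m..<n}. (c j)\<^sup>2)"
    if "m \<le> n" for m n
  proof -
    have "(\<lambda>x. S n x - S m x) = (\<lambda>x. \<Sum>j\<in>{m..<n}. c j * e j x)"
      using that by (intro ext) (simp add: S_def sum_diff lessThan_minus_lessThan flip: sum_diff)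
    then show ?thesis
      by (simp add: partial_sum_inner_self)
  qed
  have "\<exists>N. \<forall>m\<ge>N. \<forall>n. (\<Sum>j\<in>{m..<n}. (c j)\<^sup>2) < (1/4) ^ k" for k :: nat
  proof -
    obtain N where "\<And>m n. m \<ge> N \<Longrightarrow> norm (\<Sum>j\<in>{m..<n}. (c j)\<^sup>2) < (1/4) ^ k"
      using c unfolding summable_Cauchy by (metis zero_less_divide_1_iff zero_less_numeral zero_less_power)
    then show ?thesis
      by (intro exI[of _ N]) (auto simp: sum_nonneg)
  qed
  then obtain N0 where N0: "\<And>k m n. m \<ge> N0 k \<Longrightarrow> (\<Sum>j\<in>{m..<n}. (c j)\<^sup>2) < (1/4) ^ k"
    by metis
  \<comment> \<open>Adding up the thresholds makes \<open>N\<close> monotone with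
    \<open>N0 k \<le> N k\<close>; the extra summand gives \<open>k \<le> N k\<close>, so the
    subsequence passes every fixed index, as the limit inferior below requires.\<close>
  define N where "N k = (\<Sum>i\<le>k. N0 i) + k" for k
  have N_mono: "N k \<le> N (Suc k)" for k
    by (simp add: N_def)
  have N_ge: "N0 k \<le> N k" for k
    unfolding N_def by (rule trans_le_add1, rule member_le_sum) auto
  define u where "u k x = S (N (Suc k)) x - S (N k) x" for k x
  have u_L2: "u k \<in> L2 D" for k
    unfolding u_def by (intro L2_diff S_L2)
  have u_meas [measurable]: "u k \<in> borel_measurable (lebesgue_on D)" for k
    using u_L2 by (simp add: L2_iff)
  have u_sq: "(\<integral>\<^sup>+ x. ennreal ((u k x)\<^sup>2) \<partial>lebesgue_on D) \<le> ennreal ((1/4) ^ k)" for k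
    using u_L2[of k] S_diff[OF N_mono[of k]] N0[OF N_ge[of k], of "N (Suc k)"]
    by (simp add: ennreal_l2_inner_self u_def[abs_def] del: ennreal_le_iff)
      (auto intro!: ennreal_leI simp: less_imp_le)
  have "(\<integral>\<^sup>+ x. (\<Sum>k. ennreal (2 ^ k * (u k x)\<^sup>2)) \<partial>lebesgue_on D)
      = (\<Sum>k. ennreal (2 ^ k) * (\<integral>\<^sup>+ x. ennreal ((u k x)\<^sup>2) \<partial>lebesgue_on D))"
    by (subst nn_integral_suminf) (auto simp: ennreal_mult nn_integral_cmult)
  also have "\<dots> \<le> (\<Sum>k. ennreal ((1/2) ^ k))"
  proof (rule suminf_le)
    fix k
    have "ennreal (2 ^ k) * (\<integral>\<^sup>+ x. ennreal ((u k x)\<^sup>2) \<partial>lebesgue_on D) \<le> ennreal (2 ^ k) * ennreal ((1/4) ^ k)"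
      by (intro mult_left_mono u_sq) simp
    also have "\<dots> = ennreal ((1/2) ^ k)"
      by (simp add: ennreal_mult'[symmetric] power_mult_distrib[symmetric])
    finally show "ennreal (2 ^ k) * (\<integral>\<^sup>+ x. ennreal ((u k x)\<^sup>2) \<partial>lebesgue_on D) \<le> ennreal ((1/2) ^ k)" .
  qed auto
  also have "\<dots> < \<infinity>"
    by (subst suminf_ennreal2) (auto simp: summable_geometric)
  finally have "AE x in lebesgue_on D. (\<Sum>k. ennreal (2 ^ k * (u k x)\<^sup>2)) \<noteq> \<infinity>"
    by (intro nn_integral_PInf_AE) auto
  then have conv: "AE x in lebesgue_on D. convergent (\<lambda>k. S (N k) x)"
  proof eventually_elim
    case (elim x)
    have 1: "summable (\<lambda>k. 2 ^ k * (u k x)\<^sup>2)"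
      using elim by (intro summable_suminf_not_top) auto
    have "summable (\<lambda>k. u k x)"
    proof (rule summable_comparison_test')
      show "summable (\<lambda>k. (1/2) ^ k + 2 ^ k * (u k x)\<^sup>2)"
        by (intro summable_add 1 summable_geometric) simp
      fix k :: nat
      let ?p = "2 ^ k :: real"
      have "0 \<le> (1 - ?p * \<bar>u k x\<bar>)\<^sup>2 + ?p * \<bar>u k x\<bar>"
        by simp
      then have "?p * \<bar>u k x\<bar> \<le> 1 + ?p * (?p * (u k x)\<^sup>2)"
        by (simp add: power2_eq_square algebra_simps)
      then show "norm (u k x) \<le> (1/2) ^ k + ?p * (u k x)\<^sup>2"
        by (simp add: field_simps)
    qed
    then have "convergent (\<lambda>n. S (N 0) x + (\<Sum>k<n. u k x))"
      using summable_iff_convergent convergent_add convergent_const by blast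
    moreover have "S (N 0) x + (\<Sum>k<n. u k x) = S (N n) x" for n
      unfolding u_def by (subst sum_lessThan_telescope) simp
    ultimately show ?case
      by simp
  qed
  \<comment> \<open>\<open>lim\<close> keeps \<open>g\<close> measurable on the whole domain; where
    the sequence diverges its value is unspecified, but that happens only on a null set.\<close>
  define g where "g x = lim (\<lambda>k. S (N k) x)" for x
  have g_meas [measurable]: "g \<in> borel_measurable (lebesgue_on D)"
    unfolding g_def by measurable
  have g_lim: "AE x in lebesgue_on D. (\<lambda>k. S (N k) x) \<longlonglongrightarrow> g x"
    using conv by eventually_elim (simp add: g_def convergent_LIMSEQ_iff)
  have fatou: "(\<integral>\<^sup>+ x. ennreal ((S n x - g x)\<^sup>2) \<partial>lebesgue_on D) \<le> ennreal ((1/4) ^ k)"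
    if n: "n \<ge> N0 k" for n k
  proof -
    have "(\<integral>\<^sup>+ x. ennreal ((S n x - g x)\<^sup>2) \<partial>lebesgue_on D)
        = (\<integral>\<^sup>+ x. liminf (\<lambda>i. ennreal ((S n x - S (N i) x)\<^sup>2)) \<partial>lebesgue_on D)"
    proof (rule nn_integral_cong_AE)
      show "AE x in lebesgue_on D. ennreal ((S n x - g x)\<^sup>2) = liminf (\<lambda>i. ennreal ((S n x - S (N i) x)\<^sup>2))"
        using g_lim
      proof eventually_elim
        case (elim x)
        have "(\<lambda>i. ennreal ((S n x - S (N i) x)\<^sup>2)) \<longlonglongrightarrow> ennreal ((S n x - g x)\<^sup>2)"
          by (intro tendsto_intros elim)
        then show ?case
          using lim_imp_Liminf[OF sequentially_bot] by (metis (no_types))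
      qed
    qed
    also have "\<dots> \<le> liminf (\<lambda>i. \<integral>\<^sup>+ x. ennreal ((S n x - S (N i) x)\<^sup>2) \<partial>lebesgue_on D)"
      by (intro nn_integral_liminf) auto
    also have "\<dots> \<le> liminf (\<lambda>i. ennreal ((1/4) ^ k))"
    proof (rule Liminf_mono)
      show "\<forall>\<^sub>F i in sequentially. (\<integral>\<^sup>+ x. ennreal ((S n x - S (N i) x)\<^sup>2) \<partial>lebesgue_on D) \<le> ennreal ((1/4) ^ k)"
        using eventually_ge_at_top[of n]
      proof eventually_elim
        case (elim i)
        then have "n \<le> N i"
          by (simp add: N_def)
        have "(\<lambda>x. ennreal ((S n x - S (N i) x)\<^sup>2)) = (\<lambda>x. ennreal ((S (N i) x - S n x)\<^sup>2))"
          by (simp add: power2_commute)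
        then show ?case
          using S_diff[OF \<open>n \<le> N i\<close>] N0[OF n, of "N i"]
          by (simp add: ennreal_l2_inner_self L2_diff S_L2 ennreal_leI)
      qed
    qed
    finally show ?thesis
      by (simp add: Liminf_const)
  qed
  have Sg_L2: "(\<lambda>x. S n x - g x) \<in> L2 D" if n: "n \<ge> N0 k" for n k
  proof -
    have "(\<integral>\<^sup>+ x. ennreal ((S n x - g x)\<^sup>2) \<partial>lebesgue_on D) < \<infinity>"
      using fatou[OF n] by (rule order.strict_trans1) (simp add: ennreal_less_top)
    then show ?thesis
      unfolding L2_iff by (auto intro!: integrableI_bounded)
  qed
  \<comment> \<open>The Fatou bound controls only \<open>S n - g\<close>, so \<open>g\<close> is
    recovered as \<open>S n - (S n - g)\<close> with \<open>n = N0 0\<close>.\<close>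
  have g_L2: "g \<in> L2 D"
    using L2_diff[OF S_L2 Sg_L2[of 0 "N0 0"], of "N0 0"] by simp
  have "(\<lambda>n. l2_norm D (\<lambda>x. S n x - g x)) \<longlonglongrightarrow> 0"
  proof (rule LIMSEQ_I)
    fix r :: real assume "r > 0"
    obtain k where k: "(1/4) ^ k < r\<^sup>2"
      using \<open>r > 0\<close> real_arch_pow_inv[of "r\<^sup>2" "1/4"] by auto
    have "norm (l2_norm D (\<lambda>x. S n x - g x) - 0) < r" if n: "n \<ge> N0 k" for n
    proof -
      have "l2_inner D (\<lambda>x. S n x - g x) (\<lambda>x. S n x - g x) \<le> (1/4) ^ k"
        using fatou[OF n] by (simp add: ennreal_l2_inner_self[OF Sg_L2[OF n]])
      then show ?thesis
        using k \<open>r > 0\<close> by (simp add: l2_norm_def l2_inner_self_nonneg real_less_lsqrt)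
    qed
    then show "\<exists>no. \<forall>n\<ge>no. norm (l2_norm D (\<lambda>x. S n x - g x) - 0) < r"
      by blast
  qed
  then have "l2_sums D (\<lambda>j x. c j * e j x) g"
    using g_L2 by (simp add: l2_sums_def l2_tendsto_def S_def L2_scale basis_L2)
  then show ?thesis
    by blast
qed

end

section \<open>The scalar equation path by path\<close>

text \<open>Solutions are defined with Lebesgue integrals over \<open>lebesgue_on\<close>, while the
  fundamental theorem of calculus is available for the gauge integral. For continuous integrands the
  two agree, which carries over both halves of that theorem in the next two lemmas.\<close>

lemma lebesgue_on_integral_eq_integral:
  fixes f :: "real \<Rightarrow> real"
  assumes "continuous_on {a..b} f"
  shows "(LINT r|lebesgue_on {a..b}. f r) = integral {a..b} f"
  using assms by (intro lebesgue_integral_eq_integral continuous_imp_integrable_real) auto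

lemma lebesgue_on_integral_deriv:
  fixes f :: "real \<Rightarrow> real"
  assumes "continuous_on {a..b} f" and t: "t \<in> {a..b}"
  shows "((\<lambda>t. LINT r|lebesgue_on {a..t}. f r) has_real_derivative f t) (at t within {a..b})"
proof -
  have *: "(LINT r|lebesgue_on {a..u}. f r) = integral {a..u} f" if "u \<in> {a..b}" for u
    using that by (intro lebesgue_on_integral_eq_integral continuous_on_subset[OF assms(1)]) auto
  show ?thesis
    using integral_has_real_derivative[OF assms] zero_less_one t
    unfolding has_field_derivative_def
    by (rule has_derivative_transform_within) (simp add: *)
qed

lemma lebesgue_on_integral_FTC:
  fixes f :: "real \<Rightarrow> real"
  assumes "a \<le> b" "continuous_on {a..b} f"
    and "\<And>t. t \<in> {a..b} \<Longrightarrow> (g has_real_derivative f t) (at t within {a..b})"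
  shows "(LINT r|lebesgue_on {a..b}. f r) = g b - g a"
proof -
  have "(f has_integral g b - g a) {a..b}"
    using assms by (intro fundamental_theorem_of_calculus)
      (auto simp: has_real_derivative_iff_has_vector_derivative)
  then show ?thesis
    using assms by (simp add: lebesgue_on_integral_eq_integral integral_unique)
qed

text \<open>
  The solution of \<open>u t = c - a * \<integral>\<^sub>0\<^sup>t u + w t\<close> for a continuous forcing \<open>w\<close>, by variation of
  constants. Integration by parts has removed the differential of \<open>w\<close>.
\<close>

definition ou_path :: "real \<Rightarrow> real \<Rightarrow> (real \<Rightarrow> real) \<Rightarrow> real \<Rightarrow> real" where
  "ou_path a c w t = w t + exp (- a * t) * (c - a * (LINT r|lebesgue_on {0..t}. exp (a * r) * w r))"

lemma ou_path_0: "ou_path a c w 0 = w 0 + c"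
  using lebesgue_on_integral_eq_integral[of 0 0 "\<lambda>r. exp (a * r) * w r"]
  by (simp add: ou_path_def)

context
  fixes w :: "real \<Rightarrow> real" and T :: real
  assumes w: "continuous_on {0..T} w"
begin

text \<open>A Brownian forcing is continuous but not differentiable, and so is the solution.
  Subtracting the forcing leaves \<open>exp (- a * t)\<close> times a differentiable function; its
  derivative is \<open>- a * (ou_path a c w t - w t) - a * w t\<close>.\<close>

lemma ou_path_minus_forcing_deriv:
  assumes t: "t \<in> {0..T}"
  shows "((\<lambda>t. ou_path a c w t - w t) has_real_derivative - a * ou_path a c w t) (at t within {0..T})"
proof -
  let ?I = "\<lambda>t. LINT r|lebesgue_on {0..t}. exp (a * r) * w r"
  have "(?I has_real_derivative exp (a * t) * w t) (at t within {0..T})"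
    using t by (intro lebesgue_on_integral_deriv continuous_intros w)
  note I = this
  have "((\<lambda>t. exp (- a * t) * (c - a * ?I t)) has_real_derivative - a * ou_path a c w t) (at t within {0..T})"
    by (rule derivative_eq_intros I refl)+
      (simp add: ou_path_def algebra_simps flip: exp_add)
  then show ?thesis
    by (simp add: ou_path_def)
qed

lemma continuous_on_ou_path: "continuous_on {0..T} (ou_path a c w)"
proof -
  have "continuous_on {0..T} (\<lambda>t. ou_path a c w t - w t)"
    using ou_path_minus_forcing_deriv by (rule DERIV_continuous_on)
  from continuous_on_add[OF this w] show ?thesis
    by simp
qed

lemma ou_path_solves:
  assumes t: "t \<in> {0..T}"
  shows "ou_path a c w t = c - a * (LINT r|lebesgue_on {0..t}. ou_path a c w r) + w t"
proof -
  have "(LINT r|lebesgue_on {0..t}. - a * ou_path a c w r)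
      = (ou_path a c w t - w t) - (ou_path a c w 0 - w 0)"
    using t
    by (intro lebesgue_on_integral_FTC continuous_intros continuous_on_subset[OF continuous_on_ou_path]
        has_field_derivative_subset[OF ou_path_minus_forcing_deriv]) auto
  moreover have "ou_path a c w 0 - w 0 = c"
    by (simp add: ou_path_0)
  ultimately show ?thesis
    by simp
qed

text \<open>The weight \<open>a * exp (- a * (t - r))\<close> has mass
  \<open>1 - exp (- a * t)\<close> on [0, t]; an atom of mass \<open>exp (- a * t)\<close> carrying
  the value \<open>w t\<close> completes it to a probability. The mean of the values
  \<open>w t - w r\<close> and of the atom is exactly \<open>ou_path a 0 w t\<close>, and the square
  of a mean is at most the mean of the squares.\<close>

lemma ou_path_Jensen:
  assumes t: "t \<in> {0..T}" and a: "a > 0"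
  shows "(ou_path a 0 w t)\<^sup>2 \<le> exp (- a * t) * (w t)\<^sup>2 +
    (LINT r|lebesgue_on {0..t}. a * exp (- a * (t - r)) * (w t - w r)\<^sup>2)"
proof -
  define k where "k r = a * exp (- a * (t - r))" for r
  define m where "m = ou_path a 0 w t"
  define f where "f r = w t - w r" for r
  let ?M = "lebesgue_on {0..t}"
  have k: "continuous_on {0..t} k"
    unfolding k_def by (intro continuous_intros)
  have wt: "continuous_on {0..t} w"
    using t by (intro continuous_on_subset[OF w]) auto
  have f: "continuous_on {0..t} f"
    unfolding f_def by (intro continuous_intros wt)
  note int = continuous_imp_integrable_real
  have k1: "(LINT r|?M. k r) = 1 - exp (- a * t)"
  proof -
    have "(LINT r|?M. k r) = exp (- a * (t - t)) - exp (- a * (t - 0))"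
      using t by (intro lebesgue_on_integral_FTC k) (auto intro!: derivative_eq_intros simp: k_def)
    then show ?thesis
      by simp
  qed
  have "m = w t - (LINT r|?M. k r * w r)"
  proof -
    have "(LINT r|?M. k r * w r) = (LINT r|?M. (a * exp (- a * t)) * (exp (a * r) * w r))"
      by (rule Bochner_Integration.integral_cong)
        (auto simp: k_def algebra_simps simp flip: exp_add)
    also have "\<dots> = a * exp (- a * t) * (LINT r|?M. exp (a * r) * w r)"
      by (rule integral_mult_right_zero)
    finally show ?thesis
      by (simp add: m_def ou_path_def)
  qed
  moreover have "(LINT r|?M. k r * f r) = (LINT r|?M. k r * w t) - (LINT r|?M. k r * w r)"
    unfolding f_def right_diff_distrib
    by (intro Bochner_Integration.integral_diff int continuous_intros k wt)
  moreover have "(LINT r|?M. k r * w t) = (1 - exp (- a * t)) * w t"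
    by (simp add: k1)
  ultimately have m: "m = exp (- a * t) * w t + (LINT r|?M. k r * f r)"
    by (simp add: algebra_simps)
  \<comment> \<open>This integral and the term \<open>exp (- a * t) * (w t - m)^2\<close> below are
    the two parts of the variance about the mean \<open>m\<close>. Their sum is the mean square
    minus \<open>m^2\<close>.\<close>
  have "0 \<le> (LINT r|?M. k r * (f r - m)\<^sup>2)"
    using a by (intro integral_nonneg_AE) (simp add: k_def)
  also have "\<dots> = (LINT r|?M. k r * (f r)\<^sup>2 - 2 * m * (k r * f r) + m\<^sup>2 * k r)"
    by (simp add: power2_eq_square algebra_simps)
  also have "\<dots> = (LINT r|?M. k r * (f r)\<^sup>2) - (LINT r|?M. 2 * m * (k r * f r)) + (LINT r|?M. m\<^sup>2 * k r)"
    by (subst Bochner_Integration.integral_add Bochner_Integration.integral_diff;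
        (intro int continuous_intros k f)?)+ simp
  also have "\<dots> = (LINT r|?M. k r * (f r)\<^sup>2) - 2 * m * (m - exp (- a * t) * w t) + m\<^sup>2 * (1 - exp (- a * t))"
    using m by (simp add: k1)
  finally have "0 \<le> (LINT r|?M. k r * (f r)\<^sup>2) - 2 * m * (m - exp (- a * t) * w t) + m\<^sup>2 * (1 - exp (- a * t))" .
  moreover have "0 \<le> exp (- a * t) * (w t - m)\<^sup>2"
    by simp
  ultimately have "m\<^sup>2 \<le> exp (- a * t) * (w t)\<^sup>2 + (LINT r|?M. k r * (f r)\<^sup>2)"
    by (simp add: power2_eq_square algebra_simps)
  then show ?thesis
    by (simp add: m_def f_def k_def)
qed

end

lemma ou_path_add_initial: "ou_path a c w t = c * exp (- a * t) + ou_path a 0 w t"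
  by (simp add: ou_path_def algebra_simps)

text \<open>A competing solution is only known to be integrable, so regularity is bootstrapped. The
  difference \<open>d\<close> equals \<open>- a * J\<close> with \<open>J\<close> its own indefinite
  integral; \<open>J\<close> is continuous, hence so is \<open>d\<close>, hence \<open>J\<close> is
  differentiable with \<open>J' = - a * J\<close>. Then \<open>exp (a * r) * J r\<close> is
  constant, and it vanishes at 0.\<close>

lemma linear_integral_equation_unique:
  fixes u v w :: "real \<Rightarrow> real"
  assumes u: "\<And>t. t \<in> {0<..<T} \<Longrightarrow> integrable (lebesgue_on {0..t}) u"
      "\<And>t. t \<in> {0<..<T} \<Longrightarrow> u t = u 0 - a * (LINT r|lebesgue_on {0..t}. u r) + w t"
    and v: "\<And>t. t \<in> {0<..<T} \<Longrightarrow> integrable (lebesgue_on {0..t}) v"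
      "\<And>t. t \<in> {0<..<T} \<Longrightarrow> v t = v 0 - a * (LINT r|lebesgue_on {0..t}. v r) + w t"
    and "u 0 = v 0" and t: "t \<in> {0..<T}"
  shows "u t = v t"
proof (cases "t = 0")
  case False
  define d where "d r = u r - v r" for r
  define J where "J r = integral {0..r} d" for r
  have d_int: "integrable (lebesgue_on {0..r}) d" if "r \<in> {0<..<T}" for r
    unfolding d_def using u v that by auto
  have d: "d r = - a * J r" if r: "r \<in> {0..t}" for r
  proof (cases "r = 0")
    case True
    then show ?thesis
      using \<open>u 0 = v 0\<close> by (simp add: d_def J_def)
  next
    case False
    then have r: "r \<in> {0<..<T}"
      using r t by auto
    have "d r = - a * (LINT x|lebesgue_on {0..r}. d x)"
      using u(1)[OF r] v(1)[OF r] u(2)[OF r] v(2)[OF r] \<open>u 0 = v 0\<close>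
      by (simp add: d_def algebra_simps)
    also have "(LINT x|lebesgue_on {0..r}. d x) = J r"
      unfolding J_def by (intro lebesgue_integral_eq_integral d_int r) auto
    finally show ?thesis .
  qed
  have "d integrable_on {0..t}"
    using d_int[of t] t False
    by (auto simp: integrable_on_lebesgue_on)
  then have "continuous_on {0..t} J"
    unfolding J_def by (rule indefinite_integral_continuous_1)
  then have "continuous_on {0..t} (\<lambda>r. - a * J r)"
    by (rule continuous_on_mult_left)
  moreover have "continuous_on {0..t} d \<longleftrightarrow> continuous_on {0..t} (\<lambda>r. - a * J r)"
    by (intro continuous_on_cong refl d)
  ultimately have cont: "continuous_on {0..t} d"
    by simp
  have J': "(J has_real_derivative - a * J r) (at r within {0..t})" if "r \<in> {0..t}" for r
    unfolding J_def using integral_has_real_derivative[OF cont that] d[OF that] by (simp add: J_def)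
  have "\<exists>k. \<forall>r\<in>{0..t}. exp (a * r) * J r = k"
  proof (rule has_field_derivative_zero_constant)
    show "((\<lambda>r. exp (a * r) * J r) has_real_derivative 0) (at r within {0..t})" if "r \<in> {0..t}" for r
      by (rule derivative_eq_intros J' that refl)+ simp
  qed simp
  then obtain k where k: "\<And>r. r \<in> {0..t} \<Longrightarrow> exp (a * r) * J r = k"
    by blast
  have "J t = 0"
    using k[of 0] k[of t] t by (simp add: J_def)
  then show ?thesis
    using d[of t] t by (simp add: d_def)
qed (use assms in simp)

text \<open>The factor \<open>t - r\<close> is the variance of a Brownian increment, up to scale, in
  the averaged squares of \<open>ou_path_Jensen\<close>. An antiderivative in r is
  \<open>(t - r + 1 / a) * exp (- a * (t - r))\<close>.\<close>

lemma integral_exp_kernel_times_lag: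
  fixes a t :: real
  assumes "a > 0" "t \<ge> 0"
  shows "(\<integral>\<^sup>+ r. ennreal (a * exp (- a * (t - r)) * (t - r)) \<partial>lebesgue_on {0..t})
    = ennreal (1 / a - (t + 1 / a) * exp (- a * t))"
proof -
  let ?f = "\<lambda>r. a * exp (- a * (t - r)) * (t - r)"
  have f: "continuous_on {0..t} ?f"
    by (intro continuous_intros)
  have "(LINT r|lebesgue_on {0..t}. ?f r)
      = (t - t + 1 / a) * exp (- a * (t - t)) - (t - 0 + 1 / a) * exp (- a * (t - 0))"
    using assms by (intro lebesgue_on_integral_FTC f)
      (auto intro!: derivative_eq_intros simp: field_simps)
  moreover have "(\<integral>\<^sup>+ r. ennreal (?f r) \<partial>lebesgue_on {0..t}) = ennreal (LINT r|lebesgue_on {0..t}. ?f r)"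
    using assms by (intro nn_integral_eq_integral continuous_imp_integrable_real f) (auto intro!: AE_I2)
  ultimately show ?thesis
    by simp
qed

text \<open>Cauchy-Schwarz against the constant 1, obtained from the variance of \<open>f\<close>
  about its mean \<open>I / t\<close>. Enlarging t to T makes the bound independent of t.\<close>

lemma square_integral_le:
  fixes f :: "real \<Rightarrow> real"
  assumes f: "continuous_on {0..T} f" and t: "t \<in> {0..T}"
  shows "(LINT r|lebesgue_on {0..t}. f r)\<^sup>2 \<le> T * (LINT r|lebesgue_on {0..T}. (f r)\<^sup>2)"
proof (cases "t = 0")
  case True
  then show ?thesis
    using lebesgue_on_integral_eq_integral[of 0 0 f] t by simp
next
  case False
  then have "t > 0"
    using t by simp
  have ft: "continuous_on {0..t} f"
    using t by (intro continuous_on_subset[OF f]) auto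
  define I where "I = (LINT r|lebesgue_on {0..t}. f r)"
  define m where "m = I / t"
  note int = continuous_imp_integrable_real
  have "0 \<le> (LINT r|lebesgue_on {0..t}. (f r - m)\<^sup>2)"
    by (intro integral_nonneg_AE) simp
  also have "\<dots> = (LINT r|lebesgue_on {0..t}. (f r)\<^sup>2 - 2 * m * f r + m\<^sup>2)"
    by (simp add: power2_eq_square algebra_simps)
  also have "\<dots> = (LINT r|lebesgue_on {0..t}. (f r)\<^sup>2) - (LINT r|lebesgue_on {0..t}. 2 * m * f r)
      + (LINT r|lebesgue_on {0..t}. m\<^sup>2)"
    by (subst Bochner_Integration.integral_add Bochner_Integration.integral_diff;
        (intro int continuous_intros ft)?)+ simp
  also have "(LINT r|lebesgue_on {0..t}. m\<^sup>2) = t * m\<^sup>2"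
    using \<open>t > 0\<close> by (subst lebesgue_on_integral_eq_integral) auto
  also have "(LINT r|lebesgue_on {0..t}. 2 * m * f r) = 2 * m * I"
    by (simp add: I_def)
  finally have "I\<^sup>2 \<le> t * (LINT r|lebesgue_on {0..t}. (f r)\<^sup>2)"
    using \<open>t > 0\<close> by (simp add: m_def power2_eq_square field_simps)
  also have "(LINT r|lebesgue_on {0..t}. (f r)\<^sup>2) = integral {0..t} (\<lambda>r. (f r)\<^sup>2)"
    by (intro lebesgue_on_integral_eq_integral continuous_intros ft)
  also have "t * \<dots> \<le> T * integral {0..T} (\<lambda>r. (f r)\<^sup>2)"
    using t by (intro mult_mono integral_subset_le integrable_continuous_interval continuous_intros
        f ft integral_nonneg) auto
  also have "integral {0..T} (\<lambda>r. (f r)\<^sup>2) = (LINT r|lebesgue_on {0..T}. (f r)\<^sup>2)"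
    by (intro lebesgue_on_integral_eq_integral[symmetric] continuous_intros f)
  finally show ?thesis
    by (simp add: I_def)
qed

text \<open>
  The integral form of the equation turns integrability in time of \<open>\<Sum>\<^sub>j (a\<^sub>j Y\<^sub>j)\<^sup>2\<close> into
  summability at every single time, so that no maximal inequality is needed.
\<close>

lemma summable_ou_path_square:
  fixes a c :: "nat \<Rightarrow> real" and w :: "nat \<Rightarrow> real \<Rightarrow> real"
  assumes w: "\<And>j. continuous_on {0..T} (w j)" and t: "t \<in> {0..T}"
    and c: "summable (\<lambda>j. (c j)\<^sup>2)" and wt: "summable (\<lambda>j. (w j t)\<^sup>2)"
    and fin: "(\<Sum>j. \<integral>\<^sup>+ r. ennreal ((a j)\<^sup>2 * (ou_path (a j) (c j) (w j) r)\<^sup>2) \<partial>lebesgue_on {0..T}) < \<infinity>"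
  shows "summable (\<lambda>j. (ou_path (a j) (c j) (w j) t)\<^sup>2)"
proof -
  define Y where "Y j = ou_path (a j) (c j) (w j)" for j
  define I where "I j = (LINT r|lebesgue_on {0..T}. (a j * Y j r)\<^sup>2)" for j
  have Y: "continuous_on {0..T} (\<lambda>r. a j * Y j r)" for j
    unfolding Y_def by (intro continuous_intros continuous_on_ou_path w)
  have I_nonneg: "I j \<ge> 0" for j
    unfolding I_def by (intro integral_nonneg_AE) simp
  have "(\<integral>\<^sup>+ r. ennreal ((a j)\<^sup>2 * (Y j r)\<^sup>2) \<partial>lebesgue_on {0..T}) = ennreal (I j)" for j
    unfolding I_def power_mult_distrib[symmetric]
    by (intro nn_integral_eq_integral continuous_imp_integrable_real continuous_intros Y) simp
  then have I: "summable I"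
    using fin I_nonneg by (intro summable_suminf_not_top) (auto simp: Y_def)
  show ?thesis
    unfolding Y_def[symmetric]
  proof (rule summable_comparison_test')
    show "summable (\<lambda>j. 3 * ((c j)\<^sup>2 + T * I j + (w j t)\<^sup>2))"
      by (intro summable_mult summable_add c wt I)
    fix j :: nat
    define J where "J = (LINT r|lebesgue_on {0..t}. a j * Y j r)"
    have eq: "Y j t = c j - J + w j t"
      unfolding Y_def J_def by (subst ou_path_solves[OF w t]) simp
    have "J\<^sup>2 \<le> T * I j"
      unfolding J_def I_def by (rule square_integral_le[OF Y t])
    moreover have "(Y j t)\<^sup>2 \<le> 3 * ((c j)\<^sup>2 + J\<^sup>2 + (w j t)\<^sup>2)"
    proof -
      \<comment> \<open>The three squares add up exactly to the right side minus the left side of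
        the goal; their signs reflect that \<open>J\<close> enters \<open>Y j t\<close> with a
        minus.\<close>
      have "0 \<le> (c j + J)\<^sup>2 + (c j - w j t)\<^sup>2 + (J + w j t)\<^sup>2"
        by simp
      then show ?thesis
        unfolding eq by (simp add: power2_eq_square algebra_simps)
    qed
    ultimately show "norm ((Y j t)\<^sup>2) \<le> 3 * ((c j)\<^sup>2 + T * I j + (w j t)\<^sup>2)"
      by simp
  qed
qed


section \<open>Mean square estimates\<close>

text \<open>It serves as a discretisation of time with countably many values, for joint
  measurability, and as a source of rational times approaching a given one, nonnegative if
  \<open>r\<close> is.\<close>

lemma LIMSEQ_floor_fraction:
  fixes r :: real
  shows "(\<lambda>i. of_int \<lfloor>real (Suc i) * r\<rfloor> / real (Suc i)) \<longlonglongrightarrow> r"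
proof (rule tendsto_sandwich)
  have inv: "(\<lambda>i. 1 / real (Suc i)) \<longlonglongrightarrow> 0"
    using LIMSEQ_inverse_real_of_nat by (simp add: inverse_eq_divide)
  show "(\<lambda>i. r - 1 / real (Suc i)) \<longlonglongrightarrow> r"
    using tendsto_diff[OF tendsto_const[of r] inv] by simp
  show "\<forall>\<^sub>F i in sequentially. r - 1 / real (Suc i) \<le> of_int \<lfloor>real (Suc i) * r\<rfloor> / real (Suc i)"
  proof (intro always_eventually allI)
    fix i
    have "real (Suc i) * r - 1 \<le> of_int \<lfloor>real (Suc i) * r\<rfloor>"
      by linarith
    then have "(real (Suc i) * r - 1) / real (Suc i) \<le> of_int \<lfloor>real (Suc i) * r\<rfloor> / real (Suc i)"
      by (rule divide_right_mono) simp
    then show "r - 1 / real (Suc i) \<le> of_int \<lfloor>real (Suc i) * r\<rfloor> / real (Suc i)"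
      by (simp add: diff_divide_distrib del: of_nat_Suc)
  qed
  show "\<forall>\<^sub>F i in sequentially. of_int \<lfloor>real (Suc i) * r\<rfloor> / real (Suc i) \<le> r"
  proof (intro always_eventually allI)
    fix i
    have "of_int \<lfloor>real (Suc i) * r\<rfloor> \<le> real (Suc i) * r"
      by linarith
    then show "of_int \<lfloor>real (Suc i) * r\<rfloor> / real (Suc i) \<le> r"
      by (simp add: field_simps del: of_nat_Suc)
  qed
qed simp

text \<open>Freezing time on a grid of mesh \<open>1 / Suc i\<close> gives a function that depends
  on time only through an integer, so measurability at each grid point suffices. Path continuity
  gives pointwise convergence as the mesh shrinks.\<close>

lemma borel_measurable_pair_continuous_process:
  fixes X :: "real \<Rightarrow> 'w \<Rightarrow> real"
  assumes meas: "\<And>r. r \<in> {0..t} \<Longrightarrow> X r \<in> borel_measurable N"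
    and cont: "\<And>\<omega>. \<omega> \<in> space N \<Longrightarrow> continuous_on {0..t} (\<lambda>r. X r \<omega>)"
  shows "(\<lambda>(r, \<omega>). X r \<omega>) \<in> borel_measurable (lebesgue_on {0..t} \<Otimes>\<^sub>M N)"
proof (cases "t \<ge> 0")
  case True
  \<comment> \<open>The countable composition below runs over all integers \<open>k\<close>.
    Clamping keeps every grid point inside [0, t], where \<open>X\<close> is known to be measurable,
    and does not affect the limit.\<close>
  define cl where "cl r = max 0 (min t r)" for r :: real
  have cl: "cl r \<in> {0..t}" for r
    using True by (auto simp: cl_def)
  have cl_id: "cl r = r" if "r \<in> {0..t}" for r
    using that by (auto simp: cl_def)
  have cl_cont: "continuous_on UNIV cl"
    unfolding cl_def by (intro continuous_intros)
  define q :: "nat \<Rightarrow> real \<Rightarrow> int" where "q i r = \<lfloor>real (Suc i) * r\<rfloor>" for i r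
  have q: "(\<lambda>i. of_int (q i r) / real (Suc i)) \<longlonglongrightarrow> r" for r
    unfolding q_def by (rule LIMSEQ_floor_fraction)
  have fst_meas: "fst \<in> borel_measurable (lebesgue_on {0..t} \<Otimes>\<^sub>M N)"
    by (rule measurable_compose[OF measurable_fst])
      (intro continuous_imp_measurable_on_sets_lebesgue continuous_intros; simp)
  show ?thesis
  proof (rule borel_measurable_LIMSEQ_real)
    fix p assume p: "p \<in> space (lebesgue_on {0..t} \<Otimes>\<^sub>M N)"
    then have p: "fst p \<in> {0..t}" "snd p \<in> space N"
      by (auto simp: space_pair_measure space_restrict_space)
    have "(\<lambda>i. cl (of_int (q i (fst p)) / real (Suc i))) \<longlonglongrightarrow> cl (fst p)"
      using cl_cont q by (rule continuous_on_tendsto_compose) auto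
    with cont[OF p(2)] have "(\<lambda>i. X (cl (of_int (q i (fst p)) / real (Suc i))) (snd p)) \<longlonglongrightarrow> X (cl (fst p)) (snd p)"
      by (rule continuous_on_tendsto_compose) (use cl in auto)
    then show "(\<lambda>i. X (cl (of_int (q i (fst p)) / real (Suc i))) (snd p)) \<longlonglongrightarrow> (case p of (r, \<omega>) \<Rightarrow> X r \<omega>)"
      using p by (simp add: cl_id case_prod_beta)
  next
    fix i
    show "(\<lambda>p. X (cl (of_int (q i (fst p)) / real (Suc i))) (snd p)) \<in> borel_measurable (lebesgue_on {0..t} \<Otimes>\<^sub>M N)"
    proof (rule measurable_compose_countable[where g = "\<lambda>p. q i (fst p)"
          and f = "\<lambda>k p. X (cl (of_int k / real (Suc i))) (snd p)"])
      show "(\<lambda>p. X (cl (of_int k / real (Suc i))) (snd p)) \<in> borel_measurable (lebesgue_on {0..t} \<Otimes>\<^sub>M N)" for k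
        by (rule measurable_compose[OF measurable_snd meas[OF cl]])
      show "(\<lambda>p. q i (fst p)) \<in> lebesgue_on {0..t} \<Otimes>\<^sub>M N \<rightarrow>\<^sub>M count_space UNIV"
        unfolding q_def using fst_meas by measurable
    qed
  qed
next
  case False
  then have "space (lebesgue_on {0..t} \<Otimes>\<^sub>M N) = {}"
    by (auto simp: space_pair_measure space_restrict_space)
  then show ?thesis
    by (simp add: measurable_def)
qed

lemma sigma_finite_lebesgue_on_interval: "sigma_finite_measure (lebesgue_on {a..b::real})"
  using finite_measure_lebesgue_on[OF lmeasurable_interval(1)] finite_measure_def by blast

text \<open>The value at t depends only on the forcing up to t, so \<open>N\<close> may be
  \<open>F t\<close>, which yields adaptedness, as well as \<open>M\<close>.\<close>

lemma borel_measurable_ou_path: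
  fixes X :: "real \<Rightarrow> 'w \<Rightarrow> real"
  assumes meas: "\<And>r. r \<in> {0..t} \<Longrightarrow> X r \<in> borel_measurable N"
    and cont: "\<And>\<omega>. \<omega> \<in> space N \<Longrightarrow> continuous_on {0..t} (\<lambda>r. X r \<omega>)" and "t \<ge> 0"
  shows "(\<lambda>\<omega>. ou_path a c (\<lambda>r. X r \<omega>) t) \<in> borel_measurable N"
proof -
  interpret sigma_finite_measure "lebesgue_on {0..t}"
    by (rule sigma_finite_lebesgue_on_interval)
  have "(\<lambda>(r, \<omega>). exp (a * r) * X r \<omega>) \<in> borel_measurable (lebesgue_on {0..t} \<Otimes>\<^sub>M N)"
    using meas cont
    by (intro borel_measurable_pair_continuous_process borel_measurable_times continuous_intros) auto
  then have "(\<lambda>(\<omega>, r). exp (a * r) * X r \<omega>) \<in> borel_measurable (N \<Otimes>\<^sub>M lebesgue_on {0..t})"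
    by (subst measurable_pair_swap_iff) (simp add: case_prod_beta)
  then have [measurable]: "(\<lambda>\<omega>. LINT r|lebesgue_on {0..t}. exp (a * r) * X r \<omega>) \<in> borel_measurable N"
    by (rule borel_measurable_lebesgue_integral)
  have [measurable]: "X t \<in> borel_measurable N"
    using meas \<open>t \<ge> 0\<close> by simp
  show ?thesis
    unfolding ou_path_def by measurable
qed

lemma nn_integral_square_centred_normal:
  assumes "v \<ge> 0"
  shows "(\<integral>\<^sup>+ x. ennreal (x\<^sup>2) \<partial>centred_normal v) = ennreal v"
proof (cases "v = 0")
  case True
  then show ?thesis
    by (simp add: centred_normal_def nn_integral_return)
next
  case False
  then have v: "v > 0"
    using assms by simp
  have "has_bochner_integral lborel (\<lambda>x. normal_density 0 (sqrt v) x * x\<^sup>2) v"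
    using normal_moment_even[of "sqrt v" 0 1] v by (simp add: fact_numeral)
  then have "(\<integral>\<^sup>+ x. ennreal (normal_density 0 (sqrt v) x * x\<^sup>2) \<partial>lborel) = ennreal v"
    by (simp add: has_bochner_integral_iff nn_integral_eq_integral)
  then show ?thesis
    using False by (simp add: centred_normal_def nn_integral_density ennreal_mult' )
qed

context prob_space
begin

context
  fixes X :: "real \<Rightarrow> 'a \<Rightarrow> real" and T v a :: real
  assumes meas: "\<And>r. r \<in> {0..T} \<Longrightarrow> X r \<in> borel_measurable M"
    and cont: "\<And>\<omega>. \<omega> \<in> space M \<Longrightarrow> continuous_on {0..T} (\<lambda>r. X r \<omega>)"
    and X0: "\<And>\<omega>. \<omega> \<in> space M \<Longrightarrow> X 0 \<omega> = 0"
    and increments: "\<And>r t. 0 \<le> r \<Longrightarrow> r \<le> t \<Longrightarrow> t \<le> T \<Longrightarrow>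
      (\<integral>\<^sup>+ \<omega>. ennreal ((X t \<omega> - X r \<omega>)\<^sup>2) \<partial>M) = ennreal (v * (t - r))"
    and v: "v \<ge> 0" and a: "a > 0"
begin

text \<open>Taking expectations in \<open>ou_path_Jensen\<close> replaces each squared increment by
  \<open>v\<close> times its lag; \<open>X t\<close> is read as the increment from 0. The total is
  \<open>v / a * (1 - exp (- a * t))\<close>. Its bound \<open>v / a\<close> is twice the stationary
  variance of the Ornstein-Uhlenbeck process, the price of using Jensen instead of the Ito
  isometry.\<close>

lemma ou_path_second_moment:
  assumes t: "t \<in> {0..T}"
  shows "(\<integral>\<^sup>+ \<omega>. ennreal ((ou_path a 0 (\<lambda>r. X r \<omega>) t)\<^sup>2) \<partial>M) \<le> ennreal (v / a)"
proof -
  let ?L = "lebesgue_on {0..t}"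
  let ?k = "\<lambda>r. a * exp (- a * (t - r))"
  interpret L: sigma_finite_measure ?L
    by (rule sigma_finite_lebesgue_on_interval)
  interpret pair_sigma_finite ?L M ..
  have sub: "{0..t} \<subseteq> {0..T}"
    using t by auto
  have [measurable]: "X t \<in> borel_measurable M"
    using meas t by simp
  have cont_t: "continuous_on {0..t} (\<lambda>r. X r \<omega>)" if "\<omega> \<in> space M" for \<omega>
    using cont[OF that] sub by (rule continuous_on_subset)
  have k_cont: "continuous_on {0..t} (\<lambda>r. ?k r * (X t \<omega> - X r \<omega>)\<^sup>2)" if "\<omega> \<in> space M" for \<omega>
    using that by (intro continuous_intros cont_t)
  have joint: "(\<lambda>(r, \<omega>). ?k r * (X t \<omega> - X r \<omega>)\<^sup>2) \<in> borel_measurable (?L \<Otimes>\<^sub>M M)"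
  proof (rule borel_measurable_pair_continuous_process)
    fix r assume "r \<in> {0..t}"
    then have [measurable]: "X r \<in> borel_measurable M"
      using meas sub by auto
    show "(\<lambda>\<omega>. ?k r * (X t \<omega> - X r \<omega>)\<^sup>2) \<in> borel_measurable M"
      by measurable
  qed (rule k_cont)
  then have joint': "(\<lambda>(r, \<omega>). ennreal (?k r * (X t \<omega> - X r \<omega>)\<^sup>2)) \<in> borel_measurable (?L \<Otimes>\<^sub>M M)"
    by (simp add: case_prod_beta)
  have "(\<integral>\<^sup>+ \<omega>. ennreal ((ou_path a 0 (\<lambda>r. X r \<omega>) t)\<^sup>2) \<partial>M)
      \<le> (\<integral>\<^sup>+ \<omega>. ennreal (exp (- a * t)) * ennreal ((X t \<omega> - X 0 \<omega>)\<^sup>2)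
        + (\<integral>\<^sup>+ r. ennreal (?k r * (X t \<omega> - X r \<omega>)\<^sup>2) \<partial>?L) \<partial>M)"
  proof (rule nn_integral_mono)
    fix \<omega> assume \<omega>: "\<omega> \<in> space M"
    have nn: "(\<integral>\<^sup>+ r. ennreal (?k r * (X t \<omega> - X r \<omega>)\<^sup>2) \<partial>?L) = ennreal (LINT r|?L. ?k r * (X t \<omega> - X r \<omega>)\<^sup>2)"
      using a by (intro nn_integral_eq_integral continuous_imp_integrable_real k_cont \<omega>) simp
    have "0 \<le> (LINT r|?L. ?k r * (X t \<omega> - X r \<omega>)\<^sup>2)"
      using a by (intro integral_nonneg_AE) simp
    then have "ennreal (exp (- a * t)) * ennreal ((X t \<omega> - X 0 \<omega>)\<^sup>2)
          + (\<integral>\<^sup>+ r. ennreal (?k r * (X t \<omega> - X r \<omega>)\<^sup>2) \<partial>?L)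
        = ennreal (exp (- a * t) * (X t \<omega>)\<^sup>2 + (LINT r|?L. ?k r * (X t \<omega> - X r \<omega>)\<^sup>2))"
      unfolding nn using X0[OF \<omega>] by (simp add: ennreal_mult)
    then show "ennreal ((ou_path a 0 (\<lambda>r. X r \<omega>) t)\<^sup>2)
        \<le> ennreal (exp (- a * t)) * ennreal ((X t \<omega> - X 0 \<omega>)\<^sup>2)
          + (\<integral>\<^sup>+ r. ennreal (?k r * (X t \<omega> - X r \<omega>)\<^sup>2) \<partial>?L)"
      using ou_path_Jensen[OF cont[OF \<omega>] t a] by (simp add: ennreal_leI)
  qed
  also have "\<dots> = ennreal (exp (- a * t)) * ennreal (v * t)
      + (\<integral>\<^sup>+ \<omega>. (\<integral>\<^sup>+ r. ennreal (?k r * (X t \<omega> - X r \<omega>)\<^sup>2) \<partial>?L) \<partial>M)"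
  proof -
    have [measurable]: "X 0 \<in> borel_measurable M"
      using meas t by simp
    have "(\<lambda>(\<omega>, r). ennreal (?k r * (X t \<omega> - X r \<omega>)\<^sup>2)) \<in> borel_measurable (M \<Otimes>\<^sub>M ?L)"
      using joint' by (subst measurable_pair_swap_iff) (simp add: case_prod_beta)
    then have "(\<lambda>\<omega>. \<integral>\<^sup>+ r. ennreal (?k r * (X t \<omega> - X r \<omega>)\<^sup>2) \<partial>?L) \<in> borel_measurable M"
      by (rule L.borel_measurable_nn_integral)
    then show ?thesis
      using increments[of 0 t] t by (subst nn_integral_add) (auto simp: nn_integral_cmult)
  qed
  also have "(\<integral>\<^sup>+ \<omega>. (\<integral>\<^sup>+ r. ennreal (?k r * (X t \<omega> - X r \<omega>)\<^sup>2) \<partial>?L) \<partial>M)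
      = (\<integral>\<^sup>+ r. (\<integral>\<^sup>+ \<omega>. ennreal (?k r * (X t \<omega> - X r \<omega>)\<^sup>2) \<partial>M) \<partial>?L)"
    by (rule Fubini'[OF joint'])
  also have "\<dots> = (\<integral>\<^sup>+ r. ennreal v * ennreal (?k r * (t - r)) \<partial>?L)"
  proof (rule nn_integral_cong)
    fix r assume "r \<in> space ?L"
    then have r: "0 \<le> r" "r \<le> t"
      by (auto simp: space_restrict_space)
    then have [measurable]: "X r \<in> borel_measurable M"
      using meas sub by auto
    have "(\<integral>\<^sup>+ \<omega>. ennreal (?k r * (X t \<omega> - X r \<omega>)\<^sup>2) \<partial>M)
        = ennreal (?k r) * (\<integral>\<^sup>+ \<omega>. ennreal ((X t \<omega> - X r \<omega>)\<^sup>2) \<partial>M)"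
      using a by (simp add: ennreal_mult nn_integral_cmult)
    also have "\<dots> = ennreal v * ennreal (?k r * (t - r))"
      using a v t r by (simp add: increments ac_simps flip: ennreal_mult)
    finally show "(\<integral>\<^sup>+ \<omega>. ennreal (?k r * (X t \<omega> - X r \<omega>)\<^sup>2) \<partial>M) = ennreal v * ennreal (?k r * (t - r))" .
  qed
  also have "\<dots> = ennreal v * (\<integral>\<^sup>+ r. ennreal (?k r * (t - r)) \<partial>?L)"
  proof (rule nn_integral_cmult)
    have "(\<lambda>r. ?k r * (t - r)) \<in> borel_measurable ?L"
      by (intro continuous_imp_measurable_on_sets_lebesgue continuous_intros) simp
    then show "(\<lambda>r. ennreal (?k r * (t - r))) \<in> borel_measurable ?L"
      by simp
  qed
  also have "(\<integral>\<^sup>+ r. ennreal (?k r * (t - r)) \<partial>?L) = ennreal (1 / a - (t + 1 / a) * exp (- a * t))"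
    using a t by (intro integral_exp_kernel_times_lag) auto
  also have "ennreal (exp (- a * t)) * ennreal (v * t) + ennreal v * \<dots> \<le> ennreal (v / a)"
  proof -
    \<comment> \<open>Arithmetic inside \<open>ennreal\<close> needs nonnegative terms; for the
      kernel integral, nonnegativity is this inequality multiplied by
      \<open>exp (- a * t) / a\<close>.\<close>
    have "(1 + a * t) \<le> exp (a * t)"
      by (rule exp_ge_add_one_self)
    then have "0 \<le> 1 / a - (t + 1 / a) * exp (- a * t)"
      using a by (simp add: exp_minus field_simps)
    then have "ennreal (exp (- a * t)) * ennreal (v * t) + ennreal v * ennreal (1 / a - (t + 1 / a) * exp (- a * t))
        = ennreal (exp (- a * t) * (v * t) + v * (1 / a - (t + 1 / a) * exp (- a * t)))"
      using v t by (simp flip: ennreal_mult ennreal_plus)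
    also have "\<dots> \<le> ennreal (v / a)"
    proof (rule ennreal_leI)
      have "exp (- a * t) * (v * t) + v * (1 / a - (t + 1 / a) * exp (- a * t)) = v / a - v / a * exp (- a * t)"
        by (simp add: field_simps)
      then show "exp (- a * t) * (v * t) + v * (1 / a - (t + 1 / a) * exp (- a * t)) \<le> v / a"
        using v a by simp
    qed
    finally show ?thesis .
  qed
  finally show ?thesis .
qed

text \<open>The factor 2 comes from splitting off the initial value by
  \<open>(p + z)^2 \<le> 2 * p^2 + 2 * z^2\<close>. The decaying initial part integrates to at most
  \<open>c^2 / a\<close>, whatever T is; the noise part is bounded uniformly in time and contributes
  the factor T.\<close>

lemma ou_path_integrated_second_moment:
  assumes T: "T \<ge> 0"
  shows "(\<integral>\<^sup>+ \<omega>. (\<integral>\<^sup>+ t. ennreal ((ou_path a c (\<lambda>r. X r \<omega>) t)\<^sup>2) \<partial>lebesgue_on {0..T}) \<partial>M)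
    \<le> ennreal (c\<^sup>2 / a + 2 * T * (v / a))"
proof -
  let ?L = "lebesgue_on {0..T}"
  interpret L: sigma_finite_measure ?L
    by (rule sigma_finite_lebesgue_on_interval)
  interpret pair_sigma_finite ?L M ..
  have path_meas: "(\<lambda>\<omega>. ou_path a c' (\<lambda>r. X r \<omega>) t) \<in> borel_measurable M" if "t \<in> {0..T}" for t c'
    using that by (intro borel_measurable_ou_path meas continuous_on_subset[OF cont]) auto
  have "(\<lambda>(t, \<omega>). ou_path a c (\<lambda>r. X r \<omega>) t) \<in> borel_measurable (?L \<Otimes>\<^sub>M M)"
    by (intro borel_measurable_pair_continuous_process path_meas continuous_on_ou_path cont)
  then have joint: "(\<lambda>(t, \<omega>). ennreal ((ou_path a c (\<lambda>r. X r \<omega>) t)\<^sup>2)) \<in> borel_measurable (?L \<Otimes>\<^sub>M M)"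
    by (simp add: case_prod_beta)
  have exp_cont: "continuous_on {0..T} (\<lambda>t. 2 * c\<^sup>2 * exp (- 2 * a * t))"
    by (intro continuous_intros)
  have "(\<integral>\<^sup>+ \<omega>. (\<integral>\<^sup>+ t. ennreal ((ou_path a c (\<lambda>r. X r \<omega>) t)\<^sup>2) \<partial>?L) \<partial>M)
      = (\<integral>\<^sup>+ t. (\<integral>\<^sup>+ \<omega>. ennreal ((ou_path a c (\<lambda>r. X r \<omega>) t)\<^sup>2) \<partial>M) \<partial>?L)"
    by (rule Fubini'[OF joint])
  also have "\<dots> \<le> (\<integral>\<^sup>+ t. ennreal (2 * c\<^sup>2 * exp (- 2 * a * t)) + ennreal (2 * (v / a)) \<partial>?L)"
  proof (rule nn_integral_mono)
    fix t assume "t \<in> space ?L"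
    then have t: "t \<in> {0..T}"
      by (simp add: space_restrict_space)
    note [measurable] = path_meas[OF t]
    have "(\<integral>\<^sup>+ \<omega>. ennreal ((ou_path a c (\<lambda>r. X r \<omega>) t)\<^sup>2) \<partial>M)
        \<le> (\<integral>\<^sup>+ \<omega>. ennreal (2 * c\<^sup>2 * exp (- 2 * a * t))
            + ennreal 2 * ennreal ((ou_path a 0 (\<lambda>r. X r \<omega>) t)\<^sup>2) \<partial>M)"
    proof (rule nn_integral_mono)
      fix \<omega>
      let ?p = "c * exp (- a * t)" and ?z = "ou_path a 0 (\<lambda>r. X r \<omega>) t"
      have "0 \<le> (?p - ?z)\<^sup>2"
        by simp
      then have "(?p + ?z)\<^sup>2 \<le> 2 * ?p\<^sup>2 + 2 * ?z\<^sup>2"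
        by (simp add: power2_sum power2_diff)
      also have "2 * ?p\<^sup>2 = 2 * c\<^sup>2 * exp (- 2 * a * t)"
        by (simp add: power2_eq_square flip: exp_add)
      finally have "ennreal ((?p + ?z)\<^sup>2) \<le> ennreal (2 * c\<^sup>2 * exp (- 2 * a * t) + 2 * ?z\<^sup>2)"
        by (rule ennreal_leI)
      then show "ennreal ((ou_path a c (\<lambda>r. X r \<omega>) t)\<^sup>2)
          \<le> ennreal (2 * c\<^sup>2 * exp (- 2 * a * t)) + ennreal 2 * ennreal (?z\<^sup>2)"
        by (subst ou_path_add_initial) (simp only: ennreal_plus ennreal_mult zero_le_mult_iff
            zero_le_power2 exp_ge_zero zero_le_numeral simp_thms)
    qed
    also have "\<dots> = ennreal (2 * c\<^sup>2 * exp (- 2 * a * t))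
        + ennreal 2 * (\<integral>\<^sup>+ \<omega>. ennreal ((ou_path a 0 (\<lambda>r. X r \<omega>) t)\<^sup>2) \<partial>M)"
      by (subst nn_integral_add) (auto simp: nn_integral_cmult emeasure_space_1)
    also have "\<dots> \<le> ennreal (2 * c\<^sup>2 * exp (- 2 * a * t)) + ennreal 2 * ennreal (v / a)"
      by (intro add_left_mono mult_left_mono ou_path_second_moment t) simp
    also have "ennreal 2 * ennreal (v / a) = ennreal (2 * (v / a))"
      by (rule ennreal_mult'[symmetric]) simp
    finally show "(\<integral>\<^sup>+ \<omega>. ennreal ((ou_path a c (\<lambda>r. X r \<omega>) t)\<^sup>2) \<partial>M)
        \<le> ennreal (2 * c\<^sup>2 * exp (- 2 * a * t)) + ennreal (2 * (v / a))" .
  qed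
  also have "\<dots> = (\<integral>\<^sup>+ t. ennreal (2 * c\<^sup>2 * exp (- 2 * a * t)) \<partial>?L) + (\<integral>\<^sup>+ t. ennreal (2 * (v / a)) \<partial>?L)"
    by (intro nn_integral_add measurable_compose[OF _ measurable_ennreal]
        continuous_imp_measurable_on_sets_lebesgue exp_cont) auto
  also have "(\<integral>\<^sup>+ t. ennreal (2 * (v / a)) \<partial>?L) = ennreal (2 * T * (v / a))"
    using T v a by (simp add: emeasure_restrict_space space_restrict_space flip: ennreal_mult)
  also have "(\<integral>\<^sup>+ t. ennreal (2 * c\<^sup>2 * exp (- 2 * a * t)) \<partial>?L)
      = ennreal (LINT t|?L. 2 * c\<^sup>2 * exp (- 2 * a * t))"
    by (intro nn_integral_eq_integral continuous_imp_integrable_real exp_cont) simp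
  also have "(LINT t|?L. 2 * c\<^sup>2 * exp (- 2 * a * t))
      = - (c\<^sup>2 / a) * exp (- 2 * a * T) - - (c\<^sup>2 / a) * exp (- 2 * a * 0)"
    using a by (intro lebesgue_on_integral_FTC T exp_cont)
      (auto intro!: derivative_eq_intros simp: field_simps)
  also have "ennreal \<dots> \<le> ennreal (c\<^sup>2 / a)"
    using a by (intro ennreal_leI) simp
  also have "ennreal (c\<^sup>2 / a) + ennreal (2 * T * (v / a)) = ennreal (c\<^sup>2 / a + 2 * T * (v / a))"
    using a v T by (intro ennreal_plus[symmetric]) auto
  finally show ?thesis
    by (simp only: add_right_mono)
qed

end

end

section \<open>The norms of \<open>\<H>\<^sup>s\<close> in coordinates\<close>

lemma ennreal_sqrt_power2 [simp]: "(ennreal_sqrt x)\<^sup>2 = x"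
  by (cases x) (auto simp: ennreal_sqrt_def ennreal_power top_power_ennreal)

lemma ennreal_sqrt_less_top [simp]: "ennreal_sqrt x < \<top> \<longleftrightarrow> x < \<top>"
  by (auto simp: ennreal_sqrt_def less_top)

lemma borel_measurable_ennreal_sqrt [measurable]: "ennreal_sqrt \<in> borel_measurable borel"
  unfolding ennreal_sqrt_def[abs_def] by measurable

lemma L2Hs_norm_coefficients:
  assumes "\<And>t j. t \<in> {0..T} \<Longrightarrow> l2_inner D (u t) (e j) = Y j t"
  shows "L2Hs_norm D e lam s T u =
    ennreal_sqrt (\<integral>\<^sup>+ t. (\<Sum>j. ennreal (lam j powr (2 * s) * (Y j t)\<^sup>2)) \<partial>lebesgue_on {0..T})"
  unfolding L2Hs_norm_def Hs_norm_def
  using assms by (intro arg_cong[of _ _ ennreal_sqrt] nn_integral_cong) (simp add: space_restrict_space)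

lemma Hs_imp_summable:
  assumes "v \<in> Hs D e lam s"
  shows "summable (\<lambda>j. lam j powr (2 * s) * (l2_inner D v (e j))\<^sup>2)"
proof (rule summable_suminf_not_top)
  have "Hs_norm D e lam s v < \<top>"
    using assms by (simp add: Hs_def)
  then show "(\<Sum>j. ennreal (lam j powr (2 * s) * (l2_inner D v (e j))\<^sup>2)) \<noteq> \<top>"
    unfolding Hs_norm_def ennreal_sqrt_less_top by simp
qed simp


section \<open>Coefficients of the Wiener process\<close>

lemma continuous_on_l2_inner:
  assumes "\<And>t. t \<in> S \<Longrightarrow> f t \<in> L2 D"
    and "\<And>t. t \<in> S \<Longrightarrow> l2_tendsto D f (f t) (at t within S)"
    and "u \<in> L2 D" "l2_inner D u u = 1"
  shows "continuous_on S (\<lambda>t. l2_inner D (f t) u)"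
  unfolding continuous_on_def
proof
  fix t assume t: "t \<in> S"
  have "\<forall>\<^sub>F r in at t within S. f r \<in> L2 D"
    using assms(1) by (auto simp: eventually_at_filter)
  with assms t show "((\<lambda>t. l2_inner D (f t) u) \<longlongrightarrow> l2_inner D (f t) u) (at t within S)"
    by (intro l2_tendsto_imp_inner_tendsto)
qed

lemma wiener_increment_second_moment:
  assumes W: "Q_wiener_process M D Q W" and v: "v \<in> L2 D" and Qv: "l2_inner D (Q v) v = q" "q \<ge> 0"
    and r: "0 \<le> r" "r \<le> t"
  shows "(\<integral>\<^sup>+ \<omega>. ennreal ((l2_inner D (W t \<omega>) v - l2_inner D (W r \<omega>) v)\<^sup>2) \<partial>M) = ennreal (q * (t - r))"
proof (cases "r = t")
  \<comment> \<open>The definition prescribes the law of increments only for r < t; for equal times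
    both sides are 0.\<close>
  case False
  have WL2: "W t \<omega> \<in> L2 D" "W r \<omega> \<in> L2 D" if "\<omega> \<in> space M" for \<omega>
    using W that r by (auto simp: Q_wiener_process_def)
  have diff: "l2_inner D (\<lambda>x. W t \<omega> x - W r \<omega> x) v = l2_inner D (W t \<omega>) v - l2_inner D (W r \<omega>) v"
    if "\<omega> \<in> space M" for \<omega>
    by (rule l2_inner_diff_left[OF WL2[OF that] v])
  have meas: "(\<lambda>\<omega>. l2_inner D (W t \<omega>) v - l2_inner D (W r \<omega>) v) \<in> borel_measurable M"
    using W v r by (intro borel_measurable_diff) (auto simp: Q_wiener_process_def)
  have "distr M borel (\<lambda>\<omega>. l2_inner D (W t \<omega>) v - l2_inner D (W r \<omega>) v)
      = distr M borel (\<lambda>\<omega>. l2_inner D (\<lambda>x. W t \<omega> x - W r \<omega> x) v)"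
    by (rule distr_cong) (simp_all add: diff)
  also have "\<dots> = centred_normal ((t - r) * l2_inner D (Q v) v)"
    using W v r False by (auto simp: Q_wiener_process_def)
  finally have law: "distr M borel (\<lambda>\<omega>. l2_inner D (W t \<omega>) v - l2_inner D (W r \<omega>) v)
      = centred_normal ((t - r) * q)"
    by (simp add: Qv)
  have "(\<integral>\<^sup>+ \<omega>. ennreal ((l2_inner D (W t \<omega>) v - l2_inner D (W r \<omega>) v)\<^sup>2) \<partial>M)
      = (\<integral>\<^sup>+ x. ennreal (x\<^sup>2) \<partial>distr M borel (\<lambda>\<omega>. l2_inner D (W t \<omega>) v - l2_inner D (W r \<omega>) v))"
    by (subst nn_integral_distr[OF meas]) simp_all
  also have "\<dots> = (\<integral>\<^sup>+ x. ennreal (x\<^sup>2) \<partial>centred_normal ((t - r) * q))"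
    by (simp only: law)
  also have "\<dots> = ennreal (q * (t - r))"
    using Qv r by (subst nn_integral_square_centred_normal) (auto simp: mult.commute)
  finally show ?thesis .
qed simp

text \<open>The expansion of \<open>W t\<close> has an exceptional set depending on t. Restricting
  to rational times leaves a countable union of null sets, and continuity in t of both sides extends
  the identity to all times on one event.\<close>

lemma wiener_coefficients:
  assumes basis: "l2_orthonormal_basis D e" and W: "Q_wiener_process M D Q W"
    and B: "\<And>j. brownian_motion M (B j)"
    and W_expansion:
      "\<And>t. t \<ge> 0 \<Longrightarrow> AE \<omega> in M. l2_sums D (\<lambda>j x. sqrt (mu j) * e j x * B j t \<omega>) (W t \<omega>)"
  shows "AE \<omega> in M. \<forall>t\<ge>0. \<forall>j. l2_inner D (W t \<omega>) (e j) = sqrt (mu j) * B j t \<omega>"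
proof -
  let ?Q = "\<rat> \<inter> {0::real..}"
  have "AE \<omega> in M. \<forall>j. l2_inner D (W t \<omega>) (e j) = sqrt (mu j) * B j t \<omega>" if "t \<ge> 0" for t
    using W_expansion[OF that]
  proof eventually_elim
    case (elim \<omega>)
    then have "l2_sums D (\<lambda>j x. (sqrt (mu j) * B j t \<omega>) * e j x) (W t \<omega>)"
      by (simp add: ac_simps)
    then show ?case
      by (intro allI l2_sums_coefficient[OF basis])
  qed
  then have rational: "AE \<omega> in M. \<forall>t\<in>?Q. \<forall>j. l2_inner D (W t \<omega>) (e j) = sqrt (mu j) * B j t \<omega>"
    by (subst AE_ball_countable) (auto intro: countable_subset[OF _ countable_rat])
  have B_cont: "AE \<omega> in M. \<forall>j. continuous_on {0..} (\<lambda>t. B j t \<omega>)"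
    using B by (subst AE_all_countable) (auto simp: brownian_motion_def)
  have "AE \<omega> in M. \<forall>t\<ge>0. l2_tendsto D (\<lambda>r. W r \<omega>) (W t \<omega>) (at t within {0..})"
    using W by (auto simp: Q_wiener_process_def)
  with rational B_cont AE_space show ?thesis
  proof eventually_elim
    case (elim \<omega>)
    show ?case
    proof (intro allI impI)
      fix t :: real and j assume t: "t \<ge> 0"
      let ?f = "\<lambda>t. l2_inner D (W t \<omega>) (e j)" and ?g = "\<lambda>t. sqrt (mu j) * B j t \<omega>"
      have f: "continuous_on {0..} ?f"
        using elim W by (intro continuous_on_l2_inner basis_L2[OF basis])
          (auto simp: Q_wiener_process_def basis_inner[OF basis])
      have g: "continuous_on {0..} ?g"
        using elim by (intro continuous_intros) auto
      define q where "q i = of_int \<lfloor>real (Suc i) * t\<rfloor> / real (Suc i)" for i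
      have q_lim: "q \<longlonglongrightarrow> t"
        unfolding q_def by (rule LIMSEQ_floor_fraction)
      have q: "q i \<in> ?Q" for i
        using t by (simp add: q_def)
      have "(\<lambda>i. ?f (q i)) \<longlonglongrightarrow> ?f t"
        using q t by (intro continuous_on_tendsto_compose[OF f q_lim]) auto
      moreover have "(\<lambda>i. ?g (q i)) \<longlonglongrightarrow> ?g t"
        using q t by (intro continuous_on_tendsto_compose[OF g q_lim]) auto
      moreover have "?f (q i) = ?g (q i)" for i
        using elim(1) q by blast
      ultimately show "?f t = ?g t"
        using LIMSEQ_unique by simp
    qed
  qed
qed


section \<open>Existence and uniqueness\<close>

theorem theorem3p11:
  fixes D :: "real set" and T :: real and L :: ereal
    and domL :: "(real \<Rightarrow> real) set" and Lop Q :: "(real \<Rightarrow> real) \<Rightarrow> real \<Rightarrow> real"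
    and e :: "nat \<Rightarrow> real \<Rightarrow> real" and lam mu :: "nat \<Rightarrow> real" and \<alpha> :: real
    and M :: "'w measure" and F :: "real \<Rightarrow> 'w measure"
    and W :: "real \<Rightarrow> 'w \<Rightarrow> real \<Rightarrow> real" and B :: "nat \<Rightarrow> real \<Rightarrow> 'w \<Rightarrow> real"
    and y0 :: "real \<Rightarrow> real" and s :: real
  assumes D: "open D" "bounded D" "D \<noteq> {}"
    and T: "T > 0" and L: "L > 0"
    and Lop: "l2_operator D domL Lop" "l2_dense D domL" "l2_self_adjoint D domL Lop"
      "l2_positive D domL Lop" "l2_compact_inverse D domL Lop"
    and basis: "l2_orthonormal_basis D e"
    and eigen_L: "\<And>j. e j \<in> domL" "\<And>j. l2_eq D (Lop (e j)) (\<lambda>x. lam j * e j x)"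
    and lam: "\<alpha> > 0" "\<alpha> < lam 0" "mono lam" "filterlim lam at_top sequentially"
    and Q: "l2_bounded_operator D Q" "l2_self_adjoint D (L2 D) Q"
      "l2_positive_semidefinite D (L2 D) Q" "l2_finite_trace D e Q"
    and eigen_Q: "\<And>j. l2_eq D (Q (e j)) (\<lambda>x. mu j * e j x)"
    and mu: "summable mu"
    and M: "prob_space M" and F: "normal_filtration M F"
    and W: "Q_wiener_process M D Q W" "adapted_l2_process M F D W"
    and B: "\<And>j. brownian_motion M (B j)" "independent_processes M B"
    and W_expansion:
      "\<And>t. t \<ge> 0 \<Longrightarrow> AE \<omega> in M. l2_sums D (\<lambda>j x. sqrt (mu j) * e j x * B j t \<omega>) (W t \<omega>)"
    and s: "s \<in> admissible_controls L lam mu"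
    and y0: "y0 \<in> Hs D e lam (s / 2)"
  shows "\<exists>y. admissible_solution M F D T e lam mu B s y0 y \<and>
      (\<forall>y'. admissible_solution M F D T e lam mu B s y0 y' \<longrightarrow>
         (AE \<omega> in M. \<forall>t\<in>{0..<T}. l2_eq D (y' t \<omega>) (y t \<omega>)))"
proof -

  \<comment> \<open>Eigenvalues and initial data in coordinates\<close>
  interpret prob_space M by (rule M)
  note e_L2 = basis_L2[OF basis] and e_inner = basis_inner[OF basis]
  define a where "a j = lam j powr s" for j
  define c where "c j = l2_inner D y0 (e j)" for j
  have lam_pos: "lam j > 0" for j
    using lam monoD[OF lam(3), of 0 j] by simp
  have a_pos: "a j > 0" for j
    using lam_pos[of j] by (simp add: a_def)
  have a_sq: "lam j powr (2 * s) = (a j)\<^sup>2" for j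
    unfolding a_def power2_eq_square mult_2 powr_add ..
  have Qe: "l2_inner D (Q (e j)) (e j) = mu j" for j
  proof -
    have QL2: "Q (e j) \<in> L2 D"
      using Q(1) e_L2 by (auto simp: l2_bounded_operator_def l2_operator_def)
    have [measurable]: "Q (e j) \<in> borel_measurable (lebesgue_on D)" "e j \<in> borel_measurable (lebesgue_on D)"
      using QL2 e_L2 unfolding L2_iff by blast+
    have "AE x in lebesgue_on D. Q (e j) x * e j x = mu j * e j x * e j x"
      using eigen_Q[of j] unfolding l2_eq_def by eventually_elim simp
    then have "l2_inner D (Q (e j)) (e j) = l2_inner D (\<lambda>x. mu j * e j x) (e j)"
      unfolding l2_inner_def by (intro integral_cong_AE) measurable
    then show ?thesis
      by (simp add: l2_inner_scale_left e_inner)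
  qed
  have mu_nonneg: "mu j \<ge> 0" for j
    using Q(3) e_L2 unfolding l2_positive_semidefinite_def Qe[symmetric] by blast
  have mu_lam: "summable (\<lambda>j. mu j * a j)"
    using s by (auto simp: admissible_controls_def a_def)
  have c_summable: "summable (\<lambda>j. (c j)\<^sup>2)"
    using summable_coefficients[OF basis] y0 by (simp add: c_def Hs_def)
  \<comment> \<open>The norm of order s/2 doubles its exponent, so the weight is
    \<open>lam j powr s = a j\<close>, not its square.\<close>
  have c_lam: "summable (\<lambda>j. a j * (c j)\<^sup>2)"
    using Hs_imp_summable[OF y0] by (simp add: a_def c_def)

  \<comment> \<open>Filtration and continuous adapted noise coefficients\<close>
  note F_props = F[unfolded normal_filtration_def]
  have F_M: "subalgebra M (F t)" if "t \<ge> 0" for t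
    using F_props[THEN conjunct1] that by blast
  then have F_space: "space (F t) = space M" if "t \<ge> 0" for t
    using that by (simp add: subalgebra_def)
  have F_mono: "sets (F r) \<subseteq> sets (F t)" if "0 \<le> r" "r \<le> t" for r t
    using F_props[THEN conjunct2, THEN conjunct1] that by blast
  have WL2: "W t \<omega> \<in> L2 D" if "t \<ge> 0" "\<omega> \<in> space M" for t \<omega>
    using W(1) that by (auto simp: Q_wiener_process_def)

  have "AE \<omega> in M. l2_eq D (W 0 \<omega>) (\<lambda>x. 0) \<and>
      (\<forall>t\<ge>0. l2_tendsto D (\<lambda>r. W r \<omega>) (W t \<omega>) (at t within {0..}))"
    using W(1) by (auto simp: Q_wiener_process_def)
  then obtain N where N: "N \<in> null_sets M"
    and regular: "\<And>\<omega>. \<omega> \<in> space M - N \<Longrightarrow> l2_eq D (W 0 \<omega>) (\<lambda>x. 0) \<and>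
      (\<forall>t\<ge>0. l2_tendsto D (\<lambda>r. W r \<omega>) (W t \<omega>) (at t within {0..}))"
    by (rule AE_E3) blast
  have N_F: "N \<in> sets (F t)" if "t \<ge> 0" for t
    using F_props[THEN conjunct2, THEN conjunct2, THEN conjunct1] N F_mono[OF order.refl that] by blast
  have N_M: "AE \<omega> in M. \<omega> \<notin> N"
    using N by (rule AE_not_in)
  \<comment> \<open>A modification of the coefficients of \<open>W\<close> with all paths continuous; it stays adapted because
    \<open>F 0\<close> contains the null sets.\<close>
  define X where "X j t \<omega> = (if \<omega> \<in> N then 0 else l2_inner D (W t \<omega>) (e j))" for j t \<omega>
  have X_0: "X j 0 \<omega> = 0" if "\<omega> \<in> space M" for j \<omega>
  proof -
    have "l2_inner D (W 0 \<omega>) (e j) = 0" if "\<omega> \<notin> N"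
      using regular[of \<omega>] \<open>\<omega> \<in> space M\<close> that
      by (auto simp: l2_eq_def l2_inner_def intro!: integral_eq_zero_AE)
    then show ?thesis
      by (simp add: X_def)
  qed
  have X_cont: "continuous_on {0..t} (\<lambda>r. X j r \<omega>)" if "\<omega> \<in> space M" for j t \<omega>
  proof (cases "\<omega> \<in> N")
    case False
    then have "continuous_on {0..} (\<lambda>r. l2_inner D (W r \<omega>) (e j))"
      using regular[of \<omega>] that by (intro continuous_on_l2_inner e_L2) (auto simp: WL2 e_inner)
    then show ?thesis
      using False by (auto simp: X_def intro: continuous_on_subset)
  qed (simp add: X_def)
  have X_adapted: "X j r \<in> borel_measurable (F t)" if "0 \<le> r" "r \<le> t" for j r t
  proof -
    have "(\<lambda>\<omega>. l2_inner D (W r \<omega>) (e j)) \<in> borel_measurable (F r)"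
      using W(2) that e_L2 by (auto simp: adapted_l2_process_def)
    then have [measurable]: "X j r \<in> borel_measurable (F r)"
      using N_F[OF that(1)] unfolding X_def[abs_def] by (intro measurable_If_set) auto
    have "subalgebra (F t) (F r)"
      using F_mono F_space that by (simp add: subalgebra_def)
    then show ?thesis
      by (rule measurable_from_subalg) measurable
  qed
  have X_M: "X j r \<in> borel_measurable M" if "r \<ge> 0" for j r
    using X_adapted that by (intro measurable_from_subalg[OF F_M]) auto
  \<comment> \<open>\<open>W t \<omega>\<close> lies in \<open>L2\<close> for every outcome and
    every t \<ge> 0, so Bessel's inequality needs no exceptional set; on \<open>N\<close> all terms
    are 0.\<close>
  have X_summable: "summable (\<lambda>j. (X j t \<omega>)\<^sup>2)" if "t \<ge> 0" "\<omega> \<in> space M" for t \<omega>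
    using summable_coefficients[OF basis WL2[OF that]] by (cases "\<omega> \<in> N") (simp_all add: X_def)
  have X_increments: "(\<integral>\<^sup>+ \<omega>. ennreal ((X j t \<omega> - X j r \<omega>)\<^sup>2) \<partial>M) = ennreal (mu j * (t - r))"
    if "0 \<le> r" "r \<le> t" for j r t
  proof -
    have "(\<integral>\<^sup>+ \<omega>. ennreal ((X j t \<omega> - X j r \<omega>)\<^sup>2) \<partial>M)
        = (\<integral>\<^sup>+ \<omega>. ennreal ((l2_inner D (W t \<omega>) (e j) - l2_inner D (W r \<omega>) (e j))\<^sup>2) \<partial>M)"
      using N_M by (intro nn_integral_cong_AE) (auto simp: X_def)
    also have "\<dots> = ennreal (mu j * (t - r))"
      by (rule wiener_increment_second_moment[OF W(1) e_L2 Qe mu_nonneg that])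
    finally show ?thesis .
  qed
  have X_B: "AE \<omega> in M. \<forall>t\<ge>0. \<forall>j. X j t \<omega> = sqrt (mu j) * B j t \<omega>"
  proof -
    have "AE \<omega> in M. \<forall>t\<ge>0. \<forall>j. l2_inner D (W t \<omega>) (e j) = sqrt (mu j) * B j t \<omega>"
      by (rule wiener_coefficients[OF basis W(1) B(1) W_expansion])
    with N_M show ?thesis
      by eventually_elim (simp add: X_def)
  qed

  \<comment> \<open>Coordinate processes\<close>
  define Y where "Y j t \<omega> = ou_path (a j) (c j) (\<lambda>r. X j r \<omega>) t" for j t \<omega>
  have Y_cont: "continuous_on {0..t} (\<lambda>r. Y j r \<omega>)" if "\<omega> \<in> space M" for j t \<omega>
    unfolding Y_def by (intro continuous_on_ou_path X_cont that)
  have Y_0: "Y j 0 \<omega> = c j" if "\<omega> \<in> space M" for j \<omega>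
    using X_0[OF that] by (simp add: Y_def ou_path_0)
  have Y_solves: "Y j t \<omega> = Y j 0 \<omega> - a j * (LINT r|lebesgue_on {0..t}. Y j r \<omega>) + X j t \<omega>"
    if "t \<ge> 0" "\<omega> \<in> space M" for j t \<omega>
    unfolding Y_0[OF that(2)] unfolding Y_def
    using that by (intro ou_path_solves[where T = t] X_cont) auto
  have Y_adapted: "Y j t \<in> borel_measurable (F t)" if "t \<ge> 0" for j t
    unfolding Y_def[abs_def] using that
    by (intro borel_measurable_ou_path X_adapted X_cont) (auto simp: F_space)
  have Y_M: "Y j t \<in> borel_measurable M" if "t \<ge> 0" for j t
    using Y_adapted that by (intro measurable_from_subalg[OF F_M]) auto

  \<comment> \<open>Finite expectation of the squared norm\<close>
  define G where
    "G \<omega> = (\<integral>\<^sup>+ t. (\<Sum>j. ennreal (lam j powr (2 * s) * (Y j t \<omega>)\<^sup>2)) \<partial>lebesgue_on {0..T})" for \<omega>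
  interpret time: sigma_finite_measure "lebesgue_on {0..T}"
    by (rule sigma_finite_lebesgue_on_interval)
  have Y_joint: "(\<lambda>(\<omega>, t). Y j t \<omega>) \<in> borel_measurable (M \<Otimes>\<^sub>M lebesgue_on {0..T})" for j
  proof -
    have "(\<lambda>(t, \<omega>). Y j t \<omega>) \<in> borel_measurable (lebesgue_on {0..T} \<Otimes>\<^sub>M M)"
      by (intro borel_measurable_pair_continuous_process Y_M Y_cont) auto
    then show ?thesis
      by (subst measurable_pair_swap_iff) (simp add: case_prod_beta)
  qed
  then have Y_joint_sq: "(\<lambda>(\<omega>, t). ennreal (k * (Y j t \<omega>)\<^sup>2))
      \<in> borel_measurable (M \<Otimes>\<^sub>M lebesgue_on {0..T})" for k j
    by (simp add: case_prod_beta)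
  have G_meas [measurable]: "G \<in> borel_measurable M"
    unfolding G_def
  proof (rule time.borel_measurable_nn_integral)
    show "(\<lambda>(\<omega>, t). \<Sum>j. ennreal (lam j powr (2 * s) * (Y j t \<omega>)\<^sup>2))
        \<in> borel_measurable (M \<Otimes>\<^sub>M lebesgue_on {0..T})"
      using Y_joint_sq by (simp add: case_prod_beta)
  qed
  have G_eq: "G \<omega> = (\<Sum>j. \<integral>\<^sup>+ t. ennreal ((a j)\<^sup>2 * (Y j t \<omega>)\<^sup>2) \<partial>lebesgue_on {0..T})"
    if "\<omega> \<in> space M" for \<omega>
    unfolding G_def a_sq
  proof (rule nn_integral_suminf)
    fix j
    have "(\<lambda>t. (a j)\<^sup>2 * (Y j t \<omega>)\<^sup>2) \<in> borel_measurable (lebesgue_on {0..T})"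
      by (intro continuous_imp_measurable_on_sets_lebesgue continuous_intros Y_cont that) simp
    then show "(\<lambda>t. ennreal ((a j)\<^sup>2 * (Y j t \<omega>)\<^sup>2)) \<in> borel_measurable (lebesgue_on {0..T})"
      by simp
  qed
  have G_expectation: "(\<integral>\<^sup>+ \<omega>. G \<omega> \<partial>M) < \<infinity>"
  proof -
    have Y_int_meas: "(\<lambda>\<omega>. \<integral>\<^sup>+ t. ennreal (k * (Y j t \<omega>)\<^sup>2) \<partial>lebesgue_on {0..T}) \<in> borel_measurable M" for k j
      using Y_joint_sq by (rule time.borel_measurable_nn_integral)
    have "(\<integral>\<^sup>+ \<omega>. G \<omega> \<partial>M)
        = (\<integral>\<^sup>+ \<omega>. (\<Sum>j. \<integral>\<^sup>+ t. ennreal ((a j)\<^sup>2 * (Y j t \<omega>)\<^sup>2) \<partial>lebesgue_on {0..T}) \<partial>M)"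
      by (intro nn_integral_cong G_eq)
    also have "\<dots> = (\<Sum>j. \<integral>\<^sup>+ \<omega>. (\<integral>\<^sup>+ t. ennreal ((a j)\<^sup>2 * (Y j t \<omega>)\<^sup>2) \<partial>lebesgue_on {0..T}) \<partial>M)"
      by (intro nn_integral_suminf Y_int_meas)
    also have "\<dots> \<le> (\<Sum>j. ennreal (a j * (c j)\<^sup>2 + 2 * T * (mu j * a j)))"
    proof (rule suminf_le)
      fix j
      have "(\<integral>\<^sup>+ \<omega>. (\<integral>\<^sup>+ t. ennreal ((a j)\<^sup>2 * (Y j t \<omega>)\<^sup>2) \<partial>lebesgue_on {0..T}) \<partial>M)
          = (\<integral>\<^sup>+ \<omega>. ennreal ((a j)\<^sup>2) * (\<integral>\<^sup>+ t. ennreal ((Y j t \<omega>)\<^sup>2) \<partial>lebesgue_on {0..T}) \<partial>M)"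
      proof (rule nn_integral_cong)
        fix \<omega> assume "\<omega> \<in> space M"
        then have "(\<lambda>t. Y j t \<omega>) \<in> borel_measurable (lebesgue_on {0..T})"
          by (intro continuous_imp_measurable_on_sets_lebesgue Y_cont) auto
        then show "(\<integral>\<^sup>+ t. ennreal ((a j)\<^sup>2 * (Y j t \<omega>)\<^sup>2) \<partial>lebesgue_on {0..T})
            = ennreal ((a j)\<^sup>2) * (\<integral>\<^sup>+ t. ennreal ((Y j t \<omega>)\<^sup>2) \<partial>lebesgue_on {0..T})"
          by (simp add: ennreal_mult nn_integral_cmult)
      qed
      also have "\<dots> = ennreal ((a j)\<^sup>2) * (\<integral>\<^sup>+ \<omega>. (\<integral>\<^sup>+ t. ennreal ((Y j t \<omega>)\<^sup>2) \<partial>lebesgue_on {0..T}) \<partial>M)"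
        using Y_int_meas[of 1] by (intro nn_integral_cmult) simp
      also have "\<dots> \<le> ennreal ((a j)\<^sup>2) * ennreal ((c j)\<^sup>2 / a j + 2 * T * (mu j / a j))"
        unfolding Y_def using T
        by (intro mult_left_mono ou_path_integrated_second_moment X_M X_cont X_0 X_increments mu_nonneg a_pos) auto
      also have "\<dots> = ennreal (a j * (c j)\<^sup>2 + 2 * T * (mu j * a j))"
      proof -
        have "(a j)\<^sup>2 * ((c j)\<^sup>2 / a j + 2 * T * (mu j / a j)) = a j * (c j)\<^sup>2 + 2 * T * (mu j * a j)"
          using a_pos[of j] by (simp add: field_simps power2_eq_square)
        then show ?thesis
          using a_pos[of j] mu_nonneg[of j] T by (subst ennreal_mult[symmetric]) auto
      qed
      finally show "(\<integral>\<^sup>+ \<omega>. (\<integral>\<^sup>+ t. ennreal ((a j)\<^sup>2 * (Y j t \<omega>)\<^sup>2) \<partial>lebesgue_on {0..T}) \<partial>M)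
          \<le> ennreal (a j * (c j)\<^sup>2 + 2 * T * (mu j * a j))" .
    qed auto
    also have "\<dots> = ennreal (\<Sum>j. a j * (c j)\<^sup>2 + 2 * T * (mu j * a j))"
      using T a_pos mu_nonneg
      by (intro suminf_ennreal2 summable_add summable_mult c_lam mu_lam)
        (auto intro!: add_nonneg_nonneg mult_nonneg_nonneg simp: less_imp_le)
    finally show ?thesis
      by (rule order.strict_trans1) simp
  qed
  have G_fin: "AE \<omega> in M. G \<omega> < \<infinity>"
    using nn_integral_PInf_AE[OF G_meas] G_expectation by (auto simp: less_top)

  \<comment> \<open>Assembling the solution from its coordinates\<close>
  define y where "y t \<omega> = (if G \<omega> < \<infinity> \<and> t \<in> {0..T}
      then (SOME g. l2_sums D (\<lambda>j x. Y j t \<omega> * e j x) g) else (\<lambda>x. 0))" for t \<omega>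
  have y_sums: "l2_sums D (\<lambda>j x. Y j t \<omega> * e j x) (y t \<omega>)"
    if \<omega>: "\<omega> \<in> space M" "G \<omega> < \<infinity>" and t: "t \<in> {0..T}" for t \<omega>
  proof -
    have "summable (\<lambda>j. (Y j t \<omega>)\<^sup>2)"
      unfolding Y_def
    proof (rule summable_ou_path_square[OF X_cont[OF \<omega>(1)] t c_summable])
      show "summable (\<lambda>j. (X j t \<omega>)\<^sup>2)"
        using X_summable \<omega> t by simp
      show "(\<Sum>j. \<integral>\<^sup>+ r. ennreal ((a j)\<^sup>2 * (ou_path (a j) (c j) (\<lambda>r. X j r \<omega>) r)\<^sup>2) \<partial>lebesgue_on {0..T}) < \<infinity>"
        using \<omega> G_eq by (simp add: Y_def)
    qed
    then have "\<exists>g. l2_sums D (\<lambda>j x. Y j t \<omega> * e j x) g"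
      by (rule square_summable_imp_l2_sums[OF basis])
    then show ?thesis
      using \<omega> t by (simp add: y_def someI_ex)
  qed
  \<comment> \<open>The representatives come from \<open>SOME\<close> and carry no measurability in
    \<omega>. The norm sees only their coefficients, so it is a measurable function of
    \<open>G\<close>; on the event where \<open>G\<close> is infinite the zero default makes it
    0.\<close>
  have y_norm: "L2Hs_norm D e lam s T (\<lambda>t. y t \<omega>) = (if G \<omega> < \<infinity> then ennreal_sqrt (G \<omega>) else 0)"
    if \<omega>: "\<omega> \<in> space M" for \<omega>
  proof (cases "G \<omega> < \<infinity>")
    case True
    have "L2Hs_norm D e lam s T (\<lambda>t. y t \<omega>) = ennreal_sqrt (G \<omega>)"
      unfolding G_def
      by (rule L2Hs_norm_coefficients, rule l2_sums_coefficient[OF basis y_sums[OF \<omega> True]])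
    with True show ?thesis
      by simp
  next
    case False
    then have "L2Hs_norm D e lam s T (\<lambda>t. y t \<omega>) =
        ennreal_sqrt (\<integral>\<^sup>+ t. (\<Sum>j. ennreal (lam j powr (2 * s) * 0\<^sup>2)) \<partial>lebesgue_on {0..T})"
      by (intro L2Hs_norm_coefficients) (auto simp: y_def l2_inner_def)
    then show ?thesis
      using False by (simp add: ennreal_sqrt_def)
  qed
  have "admissible_solution M F D T e lam mu B s y0 y"
    unfolding admissible_solution_def
  proof (intro conjI exI[of _ Y] allI)
    have "(\<lambda>\<omega>. if G \<omega> < \<infinity> then ennreal_sqrt (G \<omega>) else 0) \<in> borel_measurable M"
      by measurable
    then show "(\<lambda>\<omega>. L2Hs_norm D e lam s T (\<lambda>t. y t \<omega>)) \<in> borel_measurable M"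
      by (simp add: y_norm cong: measurable_cong)
    show "AE \<omega> in M. L2Hs_norm D e lam s T (\<lambda>t. y t \<omega>) < \<infinity>"
      using G_fin AE_space by eventually_elim (use y_norm in simp)
    show "AE \<omega> in M. \<forall>t\<in>{0..T}. l2_sums D (\<lambda>j x. Y j t \<omega> * e j x) (y t \<omega>)"
      using G_fin AE_space by eventually_elim (use y_sums in blast)
    fix j
    show "ito_solution M F T (lam j powr s) (sqrt (mu j)) (B j) (l2_inner D y0 (e j)) (Y j)"
      unfolding ito_solution_def a_def[symmetric] c_def[symmetric]
    proof (intro conjI ballI)
      show "Y j t \<in> borel_measurable (F t)" if "t \<in> {0..T}" for t
        using that Y_adapted by simp
      show "AE \<omega> in M. Y j 0 \<omega> = c j"
        using Y_0 by (rule AE_I2)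
      show "AE \<omega> in M. \<forall>t\<in>{0<..<T}. integrable (lebesgue_on {0..t}) (\<lambda>\<tau>. Y j \<tau> \<omega>) \<and>
          Y j t \<omega> = Y j 0 \<omega> - a j * (LINT \<tau>|lebesgue_on {0..t}. Y j \<tau> \<omega>) + sqrt (mu j) * B j t \<omega>"
        using X_B AE_space
      proof eventually_elim
        case (elim \<omega>)
        show ?case
        proof
          fix t assume "t \<in> {0<..<T}"
          then have "t \<ge> 0"
            by simp
          then show "integrable (lebesgue_on {0..t}) (\<lambda>\<tau>. Y j \<tau> \<omega>) \<and>
              Y j t \<omega> = Y j 0 \<omega> - a j * (LINT \<tau>|lebesgue_on {0..t}. Y j \<tau> \<omega>) + sqrt (mu j) * B j t \<omega>"
            using elim Y_solves[of t \<omega> j] Y_cont continuous_imp_integrable_real by metis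
        qed
      qed
    qed
  qed

  \<comment> \<open>Uniqueness\<close>
  moreover have "AE \<omega> in M. \<forall>t\<in>{0..<T}. l2_eq D (y' t \<omega>) (y t \<omega>)"
    if y': "admissible_solution M F D T e lam mu B s y0 y'" for y'
  proof -
    obtain Y' where Y'_sums: "AE \<omega> in M. \<forall>t\<in>{0..T}. l2_sums D (\<lambda>j x. Y' j t \<omega> * e j x) (y' t \<omega>)"
      and Y'_ito: "\<And>j. ito_solution M F T (a j) (sqrt (mu j)) (B j) (c j) (Y' j)"
      using y' unfolding admissible_solution_def a_def c_def by blast
    have Y'_0: "AE \<omega> in M. \<forall>j. Y' j 0 \<omega> = c j"
      using Y'_ito by (subst AE_all_countable) (auto simp: ito_solution_def)
    have Y'_eq: "AE \<omega> in M. \<forall>j. \<forall>t\<in>{0<..<T}. integrable (lebesgue_on {0..t}) (\<lambda>\<tau>. Y' j \<tau> \<omega>) \<and>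
        Y' j t \<omega> = Y' j 0 \<omega> - a j * (LINT \<tau>|lebesgue_on {0..t}. Y' j \<tau> \<omega>) + sqrt (mu j) * B j t \<omega>"
      using Y'_ito by (subst AE_all_countable) (auto simp: ito_solution_def)
    show ?thesis
      using Y'_sums Y'_0 Y'_eq X_B G_fin AE_space
    proof eventually_elim
      case (elim \<omega>)
      show ?case
      proof
        fix t assume t: "t \<in> {0..<T}"
        \<comment> \<open>On this event \<open>sqrt (mu j) * B j\<close> agrees with
          \<open>X j\<close> at all times, so both coordinates satisfy the same integral equation
          with the same continuous forcing and initial value \<open>c j\<close>.\<close>
        have same: "Y' j t \<omega> = Y j t \<omega>" for j
        proof (rule linear_integral_equation_unique
            [where u = "\<lambda>t. Y' j t \<omega>" and v = "\<lambda>t. Y j t \<omega>" and w = "\<lambda>t. X j t \<omega>" and a = "a j" and T = T])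
          fix r assume r: "r \<in> {0<..<T}"
          show "integrable (lebesgue_on {0..r}) (\<lambda>r. Y' j r \<omega>)"
            using elim(3) r by blast
          show "Y' j r \<omega> = Y' j 0 \<omega> - a j * (LINT r|lebesgue_on {0..r}. Y' j r \<omega>) + X j r \<omega>"
            using elim(3,4) r by simp
          show "integrable (lebesgue_on {0..r}) (\<lambda>r. Y j r \<omega>)"
            using elim(6) by (intro continuous_imp_integrable_real Y_cont)
          show "Y j r \<omega> = Y j 0 \<omega> - a j * (LINT r|lebesgue_on {0..r}. Y j r \<omega>) + X j r \<omega>"
            using elim(6) r by (intro Y_solves) auto
        qed (use elim(2,6) Y_0 t in auto)
        have y't: "l2_sums D (\<lambda>j x. Y' j t \<omega> * e j x) (y' t \<omega>)"
          and yt: "l2_sums D (\<lambda>j x. Y j t \<omega> * e j x) (y t \<omega>)"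
          using elim t y_sums by auto
        show "l2_eq D (y' t \<omega>) (y t \<omega>)"
          using y't yt l2_sums_coefficient[OF basis y't] l2_sums_coefficient[OF basis yt]
          by (intro l2_eq_if_same_coefficients[OF basis]) (auto simp: l2_sums_def same)
      qed
    qed
  qed
  ultimately show ?thesis
    by blast
qed

end
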